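(* Let $K$ be a field, $\mathbf f=(f_1,f_2):\{1,\dots,m\}\to\mathbb N^2$ with $f_1\equiv1$, and $M$ a finitely generated bigraded $K[\mathbf f]$-module. For $n\ge1$ let $M_{n,\bullet}=\bigoplus_{d\in\mathbb Z}M_{n,d}$, filtered by $\mathcal F_\lambda M_{n,\bullet}=\bigoplus_{d\ge\lambda}M_{n,d}$ ($\lambda\in\mathbb R$), and let $\nu_n=\nu_{M_{n,\bullet}}$. Then $(T_{1/n}\nu_n)_{n\ge1}$ converges vaguely to a Borel measure $\nu$ on $\mathbb R$. If moreover $M_{n,\bullet}\ne0$ for all sufficiently large $n$, then $\nu$ is a probability measure and the polygons $P(T_{1/n}\nu_n)$ converge uniformly on $[0,1]$ to a concave function.
   Context: $K[\mathbf f]$ is $K[T_1,\dots,T_m]$ graded by $\mathbb N^2$ with $T_i$ of bidegree $\mathbf f(i)$; a bigraded module is $M=\bigoplus_{(n,d)\in\mathbb Z^2}M_{n,d}$ compatible with this grading. For a nonzero finite-dimensional vector space $W$ with a separated, exhaustive, left continuous decreasing $\mathbb R$-filtration $(\mathcal F_rW)$, $\nu_W$ is the Borel probability measure with $\nu_W([r,+\infty[)=\dim\mathcal F_rW/\dim W$; for $W=0$, $\nu_W=0$. $T_\varepsilon\nu$ is the image of $\nu$ under $x\mapsto\varepsilon x$. Vague convergence: convergence of integrals of all continuous compactly supported functions. For a probability measure $\nu$ that is a finite combination of Dirac masses, with $F(x)=\nu(]x,+\infty[)$ and $F^*(t)=\sup\{x:F(x)>t\}$, $P(\nu)(t)=\int_0^tF^*(s)\,ds$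 on $[0,1]$. *)

theory Defs
  imports "HOL-Analysis.Analysis" "HOL-Probability.Probability"
begin

text \<open>
  A bigraded module over K[f] = K[T_0,...,T_(m-1)], with T_i of bidegree f i.
  The module is a K-vector space (carrier: the type 'm, scalar multiplication sc),
  the variables act by pairwise commuting K-linear endomorphisms T i (i < m),
  and Mg n d is the homogeneous component M_(n,d) (n, d integers).
  The module is the internal direct sum of its homogeneous components and each
  T i maps M_(n,d) into M_((n,d) + f i).
\<close>

definition bigraded_module ::
  "('k::field \<Rightarrow> 'm::ab_group_add \<Rightarrow> 'm) \<Rightarrow> nat \<Rightarrow> (nat \<Rightarrow> nat \<times> nat)
    \<Rightarrow> (nat \<Rightarrow> 'm \<Rightarrow> 'm) \<Rightarrow> (int \<Rightarrow> int \<Rightarrow> 'm set) \<Rightarrow> bool" where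
  "bigraded_module sc m f T Mg \<longleftrightarrow>
     vector_space sc
   \<and> (\<forall>i<m. Vector_Spaces.linear sc sc (T i))
   \<and> (\<forall>i<m. \<forall>j<m. T i \<circ> T j = T j \<circ> T i)
   \<and> (\<forall>n d. module.subspace sc (Mg n d))
   \<and> (\<forall>i<m. \<forall>n d. T i ` Mg n d \<subseteq> Mg (n + int (fst (f i))) (d + int (snd (f i))))
   \<and> (\<forall>x. \<exists>!c :: int \<times> int \<Rightarrow> 'm. finite {p. c p \<noteq> 0}
          \<and> (\<forall>p. c p \<in> Mg (fst p) (snd p))
          \<and> x = (\<Sum>p\<in>{p. c p \<noteq> 0}. c p))"

definition submodule_generated ::
  "('k::field \<Rightarrow> 'm::ab_group_add \<Rightarrow> 'm) \<Rightarrow> nat \<Rightarrow> (nat \<Rightarrow> 'm \<Rightarrow> 'm) \<Rightarrow> 'm set \<Rightarrow> 'm set" where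
  "submodule_generated sc m T G =
     \<Inter>{S. module.subspace sc S \<and> G \<subseteq> S \<and> (\<forall>i<m. T i ` S \<subseteq> S)}"

definition finitely_generated_module ::
  "('k::field \<Rightarrow> 'm::ab_group_add \<Rightarrow> 'm) \<Rightarrow> nat \<Rightarrow> (nat \<Rightarrow> 'm \<Rightarrow> 'm) \<Rightarrow> bool" where
  "finitely_generated_module sc m T \<longleftrightarrow>
     (\<exists>G. finite G \<and> submodule_generated sc m T G = UNIV)"

definition row_space :: "('k::field \<Rightarrow> 'm::ab_group_add \<Rightarrow> 'm) \<Rightarrow> (int \<Rightarrow> int \<Rightarrow> 'm set) \<Rightarrow> int \<Rightarrow> 'm set" where
  "row_space sc Mg n = module.span sc (\<Union>d. Mg n d)"

definition row_filt :: "('k::field \<Rightarrow> 'm::ab_group_add \<Rightarrow> 'm) \<Rightarrow> (int \<Rightarrow> int \<Rightarrow> 'm set) \<Rightarrow> int \<Rightarrow> real \<Rightarrow> 'm set" where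
  "row_filt sc Mg n lam = module.span sc (\<Union>d\<in>{d. real_of_int d \<ge> lam}. Mg n d)"

definition filt_measure :: "('k::field \<Rightarrow> 'm::ab_group_add \<Rightarrow> 'm) \<Rightarrow> 'm set \<Rightarrow> (real \<Rightarrow> 'm set) \<Rightarrow> real measure" where
  "filt_measure sc W F =
     (if vector_space.dim sc W = 0 then null_measure borel
      else (THE \<mu>. sets \<mu> = sets borel \<and> prob_space \<mu> \<and>
              (\<forall>r. measure \<mu> {r..} = real (vector_space.dim sc (F r)) / real (vector_space.dim sc W))))"

definition scale_measure_by :: "real \<Rightarrow> real measure \<Rightarrow> real measure" where
  "scale_measure_by eps \<nu> = distr \<nu> borel (\<lambda>x. eps * x)"

definition vague_conv :: "(nat \<Rightarrow> real measure) \<Rightarrow> real measure \<Rightarrow> bool" where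
  "vague_conv \<mu>s \<mu> \<longleftrightarrow>
     (\<forall>g :: real \<Rightarrow> real. continuous_on UNIV g \<and> compact (closure {x. g x \<noteq> 0}) \<longrightarrow>
        (\<lambda>n. integral\<^sup>L (\<mu>s n) g) \<longlonglongrightarrow> integral\<^sup>L \<mu> g)"

definition polygon :: "real measure \<Rightarrow> real \<Rightarrow> real" where
  "polygon \<nu> t = (LBINT s=0..t. Sup {x. measure \<nu> {x<..} > s})"

end

theory Submission
  imports Defs "HOL-Computational_Algebra.Polynomial" "HOL-Library.Fun_Lexorder"
begin

text \<open>
  Choose homogeneous generators \<open>g\<^sub>j\<close> and order the vectors \<open>T\<^sup>a g\<^sub>j\<close> by decreasing second degree, then
  by \<open>j\<close>, then lexicographically in \<open>a\<close>. Those vectors which are not combinations of smaller ones in the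
  same row form a basis of the row adapted to the filtration, so \<open>\<nu>\<^sub>n\<close> is the empirical measure of
  their second degrees; moreover the order is compatible with multiplication by monomials, so for each
  \<open>j\<close> the exponents \<open>a\<close> of these vectors form a downset of \<open>\<nat>\<^sup>m\<close>. By Dickson's lemma the \<open>k\<close>-th power
  sum \<open>p\<^sub>k(n)\<close> of the second degrees in row \<open>n\<close> agrees with a polynomial in \<open>n\<close> for large \<open>n\<close>. Second
  degrees in row \<open>n\<close> are \<open>O(n)\<close>, so \<open>p\<^sub>k(n) / (n\<^sup>k p\<^sub>0(n))\<close> is a bounded quotient of polynomials
  and hence converges: all moments of the rescaled measures converge. As the supports are
  uniformly bounded, Weierstrass approximation and Helly's theorem give weak convergence, hence almost
  everywhere convergence of the quantile functions, whose primitives are the polygons.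
\<close>

section \<open>Eventually polynomial sequences\<close>

text \<open>The behaviour of Hilbert functions. Since only large arguments count, truncated
  subtraction does no harm.\<close>

definition eventually_poly :: "(nat \<Rightarrow> real) \<Rightarrow> bool" where
  "eventually_poly p \<longleftrightarrow> (\<exists>q. \<forall>\<^sub>F n in sequentially. p n = poly q (real n))"

lemma eventually_poly_add:
  assumes "eventually_poly p" "eventually_poly q"
  shows "eventually_poly (\<lambda>n. p n + q n)"
proof -
  from assms obtain P Q where "\<forall>\<^sub>F n in sequentially. p n = poly P (real n)"
    "\<forall>\<^sub>F n in sequentially. q n = poly Q (real n)"
    by (auto simp: eventually_poly_def)
  then have "\<forall>\<^sub>F n in sequentially. p n + q n = poly (P + Q) (real n)"
    by eventually_elim simp
  then show ?thesis
    unfolding eventually_poly_def by blast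
qed

lemma eventually_poly_cmult:
  assumes "eventually_poly p"
  shows "eventually_poly (\<lambda>n. c * p n)"
proof -
  from assms obtain P where "\<forall>\<^sub>F n in sequentially. p n = poly P (real n)"
    by (auto simp: eventually_poly_def)
  then have "\<forall>\<^sub>F n in sequentially. c * p n = poly (smult c P) (real n)"
    by eventually_elim simp
  then show ?thesis
    unfolding eventually_poly_def by blast
qed

lemma eventually_poly_zero: "eventually_poly (\<lambda>n. 0)"
  unfolding eventually_poly_def by (intro exI[of _ 0]) auto

lemma eventually_poly_sum:
  assumes "\<And>i. i \<in> I \<Longrightarrow> eventually_poly (p i)"
  shows "eventually_poly (\<lambda>n. \<Sum>i\<in>I. p i n)"
  using assms
  by (induction I rule: infinite_finite_induct)
     (auto intro: eventually_poly_zero eventually_poly_add)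

lemma eventually_poly_cong:
  assumes "\<forall>\<^sub>F n in sequentially. p n = q n" "eventually_poly p"
  shows "eventually_poly q"
proof -
  from assms(2) obtain P where "\<forall>\<^sub>F n in sequentially. p n = poly P (real n)"
    by (auto simp: eventually_poly_def)
  with assms(1) have "\<forall>\<^sub>F n in sequentially. q n = poly P (real n)"
    by eventually_elim simp
  then show ?thesis
    unfolding eventually_poly_def by blast
qed

lemma filterlim_nat_int_shift:
  "filterlim (\<lambda>n. nat (int n - z)) sequentially sequentially"
  unfolding filterlim_at_top eventually_sequentially
proof (intro allI)
  fix Z :: nat
  show "\<exists>N. \<forall>n\<ge>N. Z \<le> nat (int n - z)"
    by (intro exI[of _ "nat (int Z + z)"]) auto
qed

text \<open>The truncation by \<open>nat\<close> is felt only for \<open>n < z\<close>, at finitely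
  many \<open>n\<close>; beyond that the shift is composition with a linear polynomial.\<close>

lemma eventually_poly_shift:
  assumes "eventually_poly p"
  shows "eventually_poly (\<lambda>n. p (nat (int n - z)))"
proof -
  from assms obtain P where P: "\<forall>\<^sub>F n in sequentially. p n = poly P (real n)"
    by (auto simp: eventually_poly_def)
  have "\<forall>\<^sub>F n in sequentially. p (nat (int n - z)) = poly P (real (nat (int n - z)))"
    using eventually_compose_filterlim[OF P filterlim_nat_int_shift] .
  moreover have "\<forall>\<^sub>F n in sequentially. n \<ge> nat z"
    by (rule eventually_ge_at_top)
  ultimately have "\<forall>\<^sub>F n in sequentially.
      p (nat (int n - z)) = poly (pcompose P [:- of_int z, 1:]) (real n)"
  proof eventually_elim
    case (elim n)
    then have "real (nat (int n - z)) = real n - of_int z"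
      by (simp add: of_nat_nat)
    with elim show ?case
      by (simp add: poly_pcompose)
  qed
  then show ?thesis
    unfolding eventually_poly_def by blast
qed

section \<open>Finite differences of polynomials\<close>

text \<open>Induction on the degree: the difference of a suitable multiple of x^(d+1) has the
  leading term of \<open>q\<close>, and subtracting it leaves a remainder of lower degree.\<close>

lemma poly_antidifference:
  fixes q :: "real poly"
  shows "\<exists>Q. \<forall>x. poly Q (x + 1) - poly Q x = poly q x"
proof (induction "degree q" arbitrary: q rule: less_induct)
  case (less q)
  define d where "d = degree q"
  \<comment> \<open>The factor 1/(d+1) cancels the binomial coefficient of x^d in (x+1)^(d+1) -
    x^(d+1).\<close>
  define Q0 where "Q0 = monom (lead_coeff q / real (Suc d)) (Suc d)"
  define r where "r = q - (pcompose Q0 [:1, 1:] - Q0)"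
  have Q0: "poly (pcompose Q0 [:1, 1:] - Q0) x
      = lead_coeff q / real (Suc d) * (\<Sum>k\<le>d. real (Suc d choose k) * x ^ k)" for x
  proof -
    have "(x + 1) ^ Suc d = (\<Sum>k\<le>Suc d. real (Suc d choose k) * x ^ k)"
      by (subst binomial_ring) simp
    also have "\<dots> = (\<Sum>k\<le>d. real (Suc d choose k) * x ^ k) + x ^ Suc d"
      by simp
    finally have *: "(x + 1) ^ Suc d - x ^ Suc d = (\<Sum>k\<le>d. real (Suc d choose k) * x ^ k)"
      by simp
    show ?thesis
      unfolding *[symmetric] poly_diff poly_pcompose Q0_def poly_monom right_diff_distrib
      by (simp add: add.commute)
  qed
  have "poly (pcompose Q0 [:1, 1:] - Q0)
      = poly (smult (lead_coeff q / real (Suc d)) (\<Sum>k\<le>d. monom (real (Suc d choose k)) k))"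
    unfolding fun_eq_iff Q0 by (simp add: poly_sum poly_monom del: binomial_Suc_Suc)
  then have D: "pcompose Q0 [:1, 1:] - Q0
      = smult (lead_coeff q / real (Suc d)) (\<Sum>k\<le>d. monom (real (Suc d choose k)) k)"
    by (simp only: poly_eq_poly_eq_iff)
  have coeffD: "coeff (pcompose Q0 [:1, 1:] - Q0) i
      = (if i \<le> d then lead_coeff q / real (Suc d) * real (Suc d choose i) else 0)" for i
    unfolding D by (simp add: coeff_sum del: binomial_Suc_Suc of_nat_Suc)
  have r_coeff: "coeff r i = 0" if "i \<ge> d" for i
  proof (cases "i = d")
    case True
    then show ?thesis
      unfolding r_def coeff_diff[of q] coeffD
      by (simp add: d_def)
  next
    case False
    with that have "i > d" by simp
    then show ?thesis
      unfolding r_def coeff_diff[of q] coeffD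
      by (simp add: d_def coeff_eq_0)
  qed
  have "\<exists>R. \<forall>x. poly R (x + 1) - poly R x = poly r x"
  \<comment> \<open>The zero polynomial has degree 0, so \<open>degree r < d\<close> fails for it
    when \<open>d = 0\<close>; hence the separate case.\<close>
  proof (cases "r = 0")
    case True
    then show ?thesis by (intro exI[of _ 0]) simp
  next
    case False
    then have "degree r < d"
      using r_coeff[of "degree r"] by (metis leading_coeff_0_iff not_le)
    then show ?thesis
      using less[of r] by (simp add: d_def)
  qed
  then obtain R where R: "\<And>x. poly R (x + 1) - poly R x = poly r x"
    by blast
  have "poly (Q0 + R) (x + 1) - poly (Q0 + R) x = poly q x" for x
  proof -
    have "poly r x = poly q x - (poly Q0 (x + 1) - poly Q0 x)"
      by (simp add: r_def poly_pcompose add.commute)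
    with R[of x] show ?thesis by simp
  qed
  then show ?case by blast
qed

text \<open>An antidifference \<open>Q\<close> of the polynomial \<open>q\<close> has the same
  increments as \<open>p\<close> from \<open>N\<close> on, so \<open>p - Q\<close> is constant
  there.\<close>

lemma eventually_poly_of_diff:
  assumes "eventually_poly (\<lambda>n. p (Suc n) - p n)"
  shows "eventually_poly p"
proof -
  from assms obtain q where "\<forall>\<^sub>F n in sequentially. p (Suc n) - p n = poly q (real n)"
    by (auto simp: eventually_poly_def)
  then obtain N where N: "\<And>n. n \<ge> N \<Longrightarrow> p (Suc n) - p n = poly q (real n)"
    by (auto simp: eventually_sequentially)
  obtain Q where Q: "\<And>x. poly Q (x + 1) - poly Q x = poly q x"
    using poly_antidifference by blast
  define c where "c = p N - poly Q (real N)"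
  have "p n = poly (Q + [:c:]) (real n)" if "n \<ge> N" for n
    using that
  proof (induction n rule: dec_induct)
    case base
    then show ?case by (simp add: c_def)
  next
    case (step n)
    then show ?case
      using N[of n] Q[of "real n"] by (simp add: add.commute)
  qed
  then show ?thesis
    unfolding eventually_poly_def eventually_sequentially by blast
qed

section \<open>Dickson's lemma\<close>

text \<open>Every tail of a sequence of naturals attains its minimum; jumping repeatedly to a
  minimiser of the tail past the current index yields nondecreasing values.\<close>

lemma nat_seq_mono_subseq:
  fixes y :: "nat \<Rightarrow> nat"
  obtains r :: "nat \<Rightarrow> nat" where "strict_mono r" "mono (\<lambda>n. y (r n))"
proof -
  have "\<exists>k\<ge>N. \<forall>l\<ge>N. y k \<le> y l" for N
    using ex_has_least_nat[of "\<lambda>k. k \<ge> N" N y] by auto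
  then obtain g where g: "\<And>N. g N \<ge> N" "\<And>N l. l \<ge> N \<Longrightarrow> y (g N) \<le> y l"
    by metis
  define r where "r = rec_nat (g 0) (\<lambda>_ k. g (Suc k))"
  have rS: "r (Suc n) = g (Suc (r n))" for n
    by (simp add: r_def)
  have r_less: "r n < r (Suc n)" for n
    using g(1)[of "Suc (r n)"] by (simp add: rS)
  have "y (r n) \<le> y (r (Suc n))" for n
  proof (cases n)
    case 0
    then show ?thesis by (auto simp: r_def intro: g(2))
  next
    case (Suc k)
    have "Suc (r k) \<le> r (Suc n)"
      using r_less[of k] r_less[of n] by (simp add: Suc)
    then show ?thesis
      unfolding Suc rS[of k] using Suc by (intro g(2)) simp
  qed
  then show thesis
    using that[of r] r_less by (simp add: strict_mono_Suc_iff mono_iff_le_Suc)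
qed

text \<open>Dickson's lemma in sequence form. Coordinates are treated one at a time; a further
  subsequence keeps the monotonicity already gained.\<close>

lemma dickson_mono_subseq:
  fixes x :: "nat \<Rightarrow> nat \<Rightarrow> nat"
  shows "\<exists>r. strict_mono (r :: nat \<Rightarrow> nat) \<and> (\<forall>i<m. mono (\<lambda>n. x (r n) i))"
proof (induction m)
  case 0
  then show ?case by (intro exI[of _ id]) (auto simp: strict_mono_def)
next
  case (Suc m)
  then obtain r :: "nat \<Rightarrow> nat" where r: "strict_mono r" "\<forall>i<m. mono (\<lambda>n. x (r n) i)"
    by blast
  obtain s :: "nat \<Rightarrow> nat" where s: "strict_mono s" "mono (\<lambda>n. x (r (s n)) m)"
    using nat_seq_mono_subseq[of "\<lambda>n. x (r n) m"] by blast
  have "mono (\<lambda>n. x ((r \<circ> s) n) i)" if "i < Suc m" for i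
  proof (cases "i = m")
    case False
    with that r(2) have "mono (\<lambda>n. x (r n) i)" by simp
    with s(1) show ?thesis
      by (simp add: mono_def strict_mono_less_eq)
  qed (use s in simp)
  then show ?case
    using strict_mono_o[OF r(1) s(1)] by blast
qed

definition monomials :: "nat \<Rightarrow> (nat \<Rightarrow> nat) set" where
  "monomials m = {a. \<forall>i\<ge>m. a i = 0}"

text \<open>These are the complements of exponent sets of monomial ideals.\<close>

definition downset :: "nat \<Rightarrow> (nat \<Rightarrow> nat) set \<Rightarrow> bool" where
  "downset m D \<longleftrightarrow> D \<subseteq> monomials m \<and> (\<forall>b\<in>D. \<forall>a. (\<forall>i. a i \<le> b i) \<longrightarrow> a \<in> D)"

text \<open>The ascending chain condition for monomial ideals, read on complements. Without
  stabilisation each member of the chain contains an exponent that is lost later; a comparable pair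
  then puts a lost exponent below one still present.\<close>

lemma downset_chain_stabilises:
  fixes D :: "nat \<Rightarrow> (nat \<Rightarrow> nat) set"
  assumes D: "\<And>j. downset m (D j)" and anti: "antimono D"
  shows "\<exists>J. \<forall>j\<ge>J. D j = D J"
proof (rule ccontr)
  assume "\<not> ?thesis"
  then have "\<forall>J. \<exists>j\<ge>J. \<exists>a. a \<in> D J - D j"
    using antimonoD[OF anti] by (metis DiffI subsetI subset_antisym)
  then obtain nx a where nx: "\<And>J. nx J \<ge> J" and a: "\<And>J. a J \<in> D J" "\<And>J. a J \<notin> D (nx J)"
    by (metis DiffD1 DiffD2)
  \<comment> \<open>Iterating \<open>nx\<close> makes \<open>a (s n)\<close> absent from
    \<open>D (s (Suc n))\<close>, hence from every later member of the chain.\<close>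
  define s where "s = rec_nat 0 (\<lambda>_. nx)"
  have sS: "s (Suc n) = nx (s n)" for n
    by (simp add: s_def)
  have s_mono: "mono s"
    by (simp add: mono_iff_le_Suc sS nx)
  obtain r :: "nat \<Rightarrow> nat" where r: "strict_mono r" "\<forall>i<m. mono (\<lambda>n. a (s (r n)) i)"
    using dickson_mono_subseq[of m "\<lambda>n. a (s n)"] by blast
  have "a (s (r 0)) i \<le> a (s (r 1)) i" for i
  proof (cases "i < m")
    case True
    then show ?thesis using r(2) by (simp add: mono_def)
  next
    case False
    then show ?thesis
      using D a(1) unfolding downset_def monomials_def
      by (metis (mono_tags, lifting) le0 mem_Collect_eq not_le subsetD)
  qed
  moreover have "s (Suc (r 0)) \<le> s (r 1)"
    using r(1) by (intro monoD[OF s_mono]) (simp add: strict_mono_def Suc_le_eq)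
  then have "a (s (r 1)) \<in> D (nx (s (r 0)))"
    using a(1) antimonoD[OF anti] by (auto simp: sS)
  ultimately have "a (s (r 0)) \<in> D (nx (s (r 0)))"
    using D unfolding downset_def by blast
  with a(2) show False by blast
qed

section \<open>Power sums over downsets\<close>

definition mdeg :: "nat \<Rightarrow> (nat \<Rightarrow> nat) \<Rightarrow> nat" where
  "mdeg m a = (\<Sum>i<m. a i)"

definition mweight :: "nat \<Rightarrow> (nat \<Rightarrow> nat) \<Rightarrow> (nat \<Rightarrow> nat) \<Rightarrow> nat" where
  "mweight m w a = (\<Sum>i<m. w i * a i)"

text \<open>The last variable is stripped off, so that the rest is a set of exponents in
  \<open>m\<close> variables, ready for induction.\<close>

definition slice :: "nat \<Rightarrow> nat \<Rightarrow> (nat \<Rightarrow> nat) set \<Rightarrow> (nat \<Rightarrow> nat) set" where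
  "slice m j D = {a. a m = 0 \<and> a(m := j) \<in> D}"

lemma finite_monomials_of_degree: "finite {a \<in> monomials m. mdeg m a = n}"
proof (rule finite_subset)
  show "{a \<in> monomials m. mdeg m a = n}
      \<subseteq> {a. \<forall>i. (i \<in> {..<m} \<longrightarrow> a i \<in> {..n}) \<and> (i \<notin> {..<m} \<longrightarrow> a i = 0)}"
    by (auto simp: monomials_def mdeg_def intro: member_le_sum)
  show "finite {a. \<forall>i::nat. (i \<in> {..<m} \<longrightarrow> a i \<in> {..n}) \<and> (i \<notin> {..<m} \<longrightarrow> a i = (0::nat))}"
    by (rule finite_set_of_finite_funs) auto
qed

lemma downset_slice:
  assumes "downset (Suc m) D"
  shows "downset m (slice m j D)"
  unfolding downset_def
proof (intro conjI ballI allI impI subsetI)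
  fix a assume a: "a \<in> slice m j D"
  then have "a(m := j) \<in> monomials (Suc m)"
    using assms by (auto simp: slice_def downset_def)
  then show "a \<in> monomials m"
    using a unfolding slice_def monomials_def
    by (auto simp: Suc_le_eq) (metis le_neq_implies_less)
next
  fix a b assume b: "b \<in> slice m j D" and le: "\<forall>i. a i \<le> b i"
  have "a(m := j) \<in> D"
    using assms b le unfolding downset_def slice_def by (auto split: if_splits)
  moreover have "a m = 0"
    using b le by (auto simp: slice_def) (metis le_zero_eq)
  ultimately show "a \<in> slice m j D"
    by (simp add: slice_def)
qed

lemma antimono_slice:
  assumes "downset (Suc m) D"
  shows "antimono (\<lambda>j. slice m j D)"
proof (intro antimonoI subsetI)
  fix i j :: nat and a assume "i \<le> j" "a \<in> slice m j D"
  then show "a \<in> slice m i D"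
    using assms unfolding downset_def slice_def by auto
qed

text \<open>The constant \<open>c\<close> will hold the second degree of a generator and, during the
  induction, also the contribution of variables already stripped off.\<close>

definition power_sum :: "nat \<Rightarrow> (nat \<Rightarrow> nat) \<Rightarrow> (nat \<Rightarrow> nat) set \<Rightarrow> real \<Rightarrow> nat \<Rightarrow> nat \<Rightarrow> real" where
  "power_sum m w D c k n = (\<Sum>a \<in> {a\<in>D. mdeg m a = n}. (c + real (mweight m w a)) ^ k)"

text \<open>Monomials are sorted by the exponent \<open>j\<close> of the last variable, whose weight
  moves into the constant.\<close>

lemma power_sum_slices:
  assumes "downset (Suc m) D"
  shows "power_sum (Suc m) w D c k n
    = (\<Sum>j\<le>n. power_sum m w (slice m j D) (c + real (w m) * real j) k (n - j))"
proof -
  let ?A = "\<lambda>j. {a\<in>slice m j D. mdeg m a = n - j}"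
  have upd: "mdeg m (a(m := j)) = mdeg m a" "mweight m w (a(m := j)) = mweight m w a" for a j
    by (auto simp: mdeg_def mweight_def intro!: sum.cong)
  have fin: "finite (?A j)" for j
    by (rule finite_subset[OF _ finite_monomials_of_degree[of m "n - j"]])
       (use downset_slice[OF assms] in \<open>auto simp: downset_def\<close>)
  have "(\<Sum>j\<le>n. power_sum m w (slice m j D) (c + real (w m) * real j) k (n - j))
      = (\<Sum>(j, a) \<in> Sigma {..n} ?A. (c + real (w m) * real j + real (mweight m w a)) ^ k)"
    unfolding power_sum_def using fin by (subst sum.Sigma) auto
  also have "\<dots> = power_sum (Suc m) w D c k n"
    unfolding power_sum_def
  proof (rule sum.reindex_bij_witness[where i = "\<lambda>a. (a m, a(m := 0))" and j = "\<lambda>(j, a). a(m := j)"])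
    fix p assume "p \<in> Sigma {..n} ?A"
    then show "(\<lambda>a. (a m, a(m := 0))) ((\<lambda>(j, a). a(m := j)) p) = p"
      by (auto simp: slice_def)
  next
    fix p assume "p \<in> Sigma {..n} ?A"
    then show "(\<lambda>(j, a). a(m := j)) p \<in> {a \<in> D. mdeg (Suc m) a = n}"
      by (auto simp: slice_def mdeg_def)
  next
    fix p assume "p \<in> Sigma {..n} ?A"
    show "(c + real (mweight (Suc m) w ((\<lambda>(j, a). a(m := j)) p))) ^ k =
       (case p of (j, a) \<Rightarrow> (c + real (w m) * real j + real (mweight m w a)) ^ k)"
      by (cases p) (simp add: upd, simp add: mweight_def algebra_simps)
  qed (auto simp: slice_def mdeg_def)
  finally show ?thesis ..
qed

text \<open>Binomial expansion in \<open>h\<close>: a change of the constant is traded for power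
  sums of order at most \<open>k\<close> with the old constant.\<close>

lemma power_sum_shift_const:
  "power_sum m w D (c + h) k n = (\<Sum>l\<le>k. real (k choose l) * h ^ (k - l) * power_sum m w D c l n)"
proof -
  have "power_sum m w D (c + h) k n
      = (\<Sum>a \<in> {a\<in>D. mdeg m a = n}. \<Sum>l\<le>k. real (k choose l) * (c + real (mweight m w a)) ^ l * h ^ (k - l))"
    unfolding power_sum_def
    by (intro sum.cong refl) (subst binomial_ring[symmetric], simp add: algebra_simps)
  then show ?thesis
    unfolding power_sum_def by (subst (asm) sum.swap) (simp add: sum_distrib_left mult_ac)
qed

text \<open>Induction on \<open>k\<close>: the difference sequence only involves lower powers.\<close>

lemma eventually_poly_power_sum_prism:
  assumes E: "\<And>c k. eventually_poly (power_sum m w E c k)"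
  shows "eventually_poly (\<lambda>n. \<Sum>j\<le>n. power_sum m w E (c + h * real j) k (n - j))"
proof (induction k rule: less_induct)
  case (less k)
  define P where "P l n = (\<Sum>j\<le>n. power_sum m w E (c + h * real j) l (n - j))" for l n
  have "P k (Suc n) - P k n = power_sum m w E c k (Suc n)
      + (\<Sum>l<k. real (k choose l) * h ^ (k - l) * P l n)" for n
  proof -
    \<comment> \<open>Splitting off \<open>j = 0\<close> and replacing \<open>j\<close> by
      \<open>j + 1\<close> keeps the degrees \<open>n - j\<close> and raises the constant by
      \<open>h\<close>.\<close>
    have "P k (Suc n) = power_sum m w E c k (Suc n)
        + (\<Sum>j\<le>n. power_sum m w E (c + h * real j + h) k (n - j))"
      unfolding P_def by (subst sum.atMost_Suc_shift) (simp add: algebra_simps)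
    also have "(\<Sum>j\<le>n. power_sum m w E (c + h * real j + h) k (n - j))
        = (\<Sum>l\<le>k. real (k choose l) * h ^ (k - l) * P l n)"
      unfolding P_def power_sum_shift_const[of _ _ _ _ h]
      by (subst sum.swap) (simp add: sum_distrib_left)
    \<comment> \<open>The coefficient at \<open>l = k\<close> is 1, so this term is
      \<open>P k n\<close> and cancels in the difference.\<close>
    also have "\<dots> = (\<Sum>l<k. real (k choose l) * h ^ (k - l) * P l n) + P k n"
      by (subst lessThan_Suc_atMost[symmetric]) simp
    finally show ?thesis by simp
  qed
  moreover have "eventually_poly (\<lambda>n. power_sum m w E c k (Suc n)
      + (\<Sum>l<k. real (k choose l) * h ^ (k - l) * P l n))"
    using eventually_poly_shift[OF E[of c k], of "-1"] less
    by (intro eventually_poly_add eventually_poly_sum eventually_poly_cmult)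
       (auto simp: P_def nat_add_distrib)
  ultimately have "eventually_poly (P k)"
    using eventually_poly_of_diff[of "P k"] by simp
  then show ?case
    by (simp add: P_def[abs_def])
qed

text \<open>Induction on the number of variables. The slices equal a fixed \<open>E\<close> from
  some \<open>J\<close> on, so \<open>D\<close> consists of finitely many slices and a prism over
  \<open>E\<close>.\<close>

lemma eventually_poly_power_sum:
  assumes "downset m D"
  shows "eventually_poly (power_sum m w D c k)"
  using assms
proof (induction m arbitrary: D c k)
  case 0
  \<comment> \<open>Without variables only degree 0 occurs, so the sum is empty for
    \<open>n > 0\<close>.\<close>
  have "\<forall>\<^sub>F n in sequentially. 0 = power_sum 0 w D c k n"
    using eventually_gt_at_top[of "0::nat"]
    by eventually_elim (simp add: power_sum_def mdeg_def)
  then show ?case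
    by (rule eventually_poly_cong[OF _ eventually_poly_zero])
next
  case (Suc m)
  note D = \<open>downset (Suc m) D\<close>
  obtain J where "\<forall>j\<ge>J. slice m j D = slice m J D"
    using downset_chain_stabilises[of m "\<lambda>j. slice m j D"] downset_slice[OF D] antimono_slice[OF D]
    by blast
  then obtain E where J: "\<And>j. j \<ge> J \<Longrightarrow> slice m j D = E"
    by blast
  define h where "h = real (w m)"
  have IH: "eventually_poly (power_sum m w (slice m j D) c k)" for j c k
    using Suc.IH downset_slice[OF D] by blast
  \<comment> \<open>For \<open>n \<ge> J\<close> the truncated differences are exact; in the form
    with \<open>nat\<close> they fit \<open>eventually_poly_shift\<close>.\<close>
  have split: "power_sum (Suc m) w D c k n
      = (\<Sum>j<J. power_sum m w (slice m j D) (c + h * real j) k (nat (int n - int j)))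
      + (\<Sum>j\<le>nat (int n - int J). power_sum m w E (c + h * real J + h * real j) k (nat (int n - int J) - j))"
    if "n \<ge> J" for n
  proof -
    have nJ: "nat (int n - int J) = n - J"
      using that by linarith
    have "(\<Sum>j\<le>n. power_sum m w (slice m j D) (c + h * real j) k (n - j))
      = (\<Sum>j<J. power_sum m w (slice m j D) (c + h * real j) k (n - j))
      + (\<Sum>j\<in>{J..n}. power_sum m w (slice m j D) (c + h * real j) k (n - j))"
      using that by (subst sum.union_disjoint[symmetric]) (auto intro!: sum.cong)
    also have "(\<Sum>j\<in>{J..n}. power_sum m w (slice m j D) (c + h * real j) k (n - j))
      = (\<Sum>j\<le>n - J. power_sum m w E (c + h * real J + h * real j) k (n - J - j))"
      by (rule sum.reindex_bij_witness[where i = "\<lambda>j. J + j" and j = "\<lambda>j. j - J"])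
         (use that in \<open>auto simp: J algebra_simps\<close>)
    also have "(\<Sum>j<J. power_sum m w (slice m j D) (c + h * real j) k (n - j))
      = (\<Sum>j<J. power_sum m w (slice m j D) (c + h * real j) k (nat (int n - int j)))"
      using that by (intro sum.cong refl) (simp add: nat_diff_distrib)
    finally show ?thesis
      unfolding power_sum_slices[OF D] h_def[symmetric] nJ .
  qed
  have tail: "eventually_poly (\<lambda>n. \<Sum>j\<le>n. power_sum m w E (c + h * real J + h * real j) k (n - j))"
    by (rule eventually_poly_power_sum_prism) (use IH[of J] J[of J] in simp)
  have "eventually_poly (\<lambda>n.
      (\<Sum>j<J. power_sum m w (slice m j D) (c + h * real j) k (nat (int n - int j)))
      + (\<Sum>j\<le>nat (int n - int J). power_sum m w E (c + h * real J + h * real j) k (nat (int n - int J) - j)))"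
    by (intro eventually_poly_add eventually_poly_sum eventually_poly_shift[OF IH]
        eventually_poly_shift[OF tail])
  moreover have "\<forall>\<^sub>F n in sequentially.
      (\<Sum>j<J. power_sum m w (slice m j D) (c + h * real j) k (nat (int n - int j)))
      + (\<Sum>j\<le>nat (int n - int J). power_sum m w E (c + h * real J + h * real j) k (nat (int n - int J) - j))
      = power_sum (Suc m) w D c k n"
    using eventually_ge_at_top[of J] by eventually_elim (rule split[symmetric])
  ultimately show ?case
    by (rule eventually_poly_cong[rotated])
qed

section \<open>Standard indices of an ordered family of vectors\<close>

text \<open>Greedy choice of a basis. Removing the largest index \<open>x\<close> leaves the other
  initial segments unchanged, and the segment of \<open>x\<close> is all that remains; so
  \<open>v x\<close> is kept exactly when it enlarges the span.\<close>

lemma (in vector_space) standard_indices_basis: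
  fixes v :: "'i \<Rightarrow> 'b" and R :: "'i \<Rightarrow> 'i \<Rightarrow> bool"
  assumes "finite I" "asymp_on I R" "transp_on I R" "totalp_on I R"
  shows "inj_on v {i\<in>I. v i \<notin> span (v ` {j\<in>I. R j i})}
       \<and> independent (v ` {i\<in>I. v i \<notin> span (v ` {j\<in>I. R j i})})
       \<and> span (v ` {i\<in>I. v i \<notin> span (v ` {j\<in>I. R j i})}) = span (v ` I)"
  using assms
proof (induction I rule: finite_psubset_induct)
  case (psubset I)
  let ?S = "\<lambda>I. {i\<in>I. v i \<notin> span (v ` {j\<in>I. R j i})}"
  show ?case
  proof (cases "I = {}")
    case False
    obtain x where x: "x \<in> I" "\<And>y. y \<in> I \<Longrightarrow> y \<noteq> x \<Longrightarrow> \<not> R x y"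
      using Finite_Set.bex_max_element[OF psubset(1,3,4) False] by blast
    define I' where "I' = I - {x}"
    have Rx: "R y x" if "y \<in> I'" for y
      using psubset(5) x that by (auto simp: I'_def totalp_on_def)
    have nR: "\<not> R x y" if "y \<in> I" for y
      using psubset(3) x that by (metis asymp_onD)
    have sub: "I' \<subset> I"
      using x(1) by (auto simp: I'_def)
    have "asymp_on I' R" "transp_on I' R" "totalp_on I' R"
      using psubset(3-5) sub
      by (auto intro: asymp_on_subset transp_on_subset totalp_on_subset)
    from psubset(2)[OF sub this]
    have IH: "inj_on v (?S I')" "independent (v ` ?S I')" "span (v ` ?S I') = span (v ` I')"
      by blast+
    have seg: "{j\<in>I. R j i} = {j\<in>I'. R j i}" if "i \<in> I'" for i
      using nR that by (auto simp: I'_def)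
    have segx: "{j\<in>I. R j x} = I'"
      using Rx nR[OF x(1)] by (auto simp: I'_def)
    have I: "I = insert x I'" "x \<notin> I'"
      using x by (auto simp: I'_def)
    show ?thesis
    proof (cases "v x \<in> span (v ` I')")
      case True
      then have "?S I = ?S I'"
        using seg segx I by auto
      moreover have "span (v ` I) = span (v ` I')"
        using True by (simp add: I(1) span_redundant)
      ultimately show ?thesis
        using IH by simp
    next
      case False
      then have S: "?S I = insert x (?S I')"
        using seg segx I by auto
      have "v x \<notin> v ` ?S I'"
        using False span_superset by blast
      moreover have "independent (insert (v x) (v ` ?S I'))"
        using False IH by (intro independent_insertI) auto
      moreover have "span (insert (v x) (v ` ?S I')) = span (v ` I)"
        unfolding I(1) image_insert using IH(3) by (simp add: span_insert)
      ultimately show ?thesis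
        unfolding S using IH I(2) by auto
    qed
  qed (auto simp: independent_empty)
qed

section \<open>The action of monomials\<close>

primrec mon_act :: "(nat \<Rightarrow> 'a \<Rightarrow> 'a) \<Rightarrow> nat \<Rightarrow> (nat \<Rightarrow> nat) \<Rightarrow> 'a \<Rightarrow> 'a" where
  "mon_act T 0 a = id"
| "mon_act T (Suc k) a = (T k ^^ a k) \<circ> mon_act T k a"

lemma funpow_commute:
  assumes "g \<circ> h = h \<circ> g"
  shows "g \<circ> (h ^^ n) = (h ^^ n) \<circ> g"
proof (induction n)
  case (Suc n)
  then show ?case
    using assms by (simp add: fun_eq_iff)
qed simp

lemma mon_act_commute:
  assumes "\<And>i. i < k \<Longrightarrow> g \<circ> T i = T i \<circ> g"
  shows "g \<circ> mon_act T k a = mon_act T k a \<circ> g"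
  using assms
proof (induction k)
  case (Suc k)
  have "g \<circ> (T k ^^ a k) = (T k ^^ a k) \<circ> g"
    by (rule funpow_commute, rule Suc.prems) simp
  moreover have "g \<circ> mon_act T k a = mon_act T k a \<circ> g"
    by (rule Suc.IH, rule Suc.prems) simp
  ultimately show ?case
    by (simp add: fun_eq_iff)
qed simp

text \<open>Commutativity lets the power of the last variable pass the action of the earlier
  ones.\<close>

lemma mon_act_add:
  assumes "\<And>i j. i < k \<Longrightarrow> j < k \<Longrightarrow> T i \<circ> T j = T j \<circ> T i"
  shows "mon_act T k (\<lambda>i. a i + b i) = mon_act T k a \<circ> mon_act T k b"
  using assms
proof (induction k)
  case (Suc k)
  have "(T k ^^ b k) \<circ> T i = T i \<circ> (T k ^^ b k)" if "i < k" for i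
    by (rule funpow_commute[symmetric], rule Suc.prems) (use that in auto)
  then have "(T k ^^ b k) \<circ> mon_act T k a = mon_act T k a \<circ> (T k ^^ b k)"
    by (intro mon_act_commute)
  moreover have "mon_act T k (\<lambda>i. a i + b i) = mon_act T k a \<circ> mon_act T k b"
    by (rule Suc.IH, rule Suc.prems) auto
  ultimately show ?case
    by (simp add: fun_eq_iff funpow_add)
qed simp

lemma mon_act_single:
  "mon_act T k (\<lambda>l. if l = i then 1 else 0) = (if i < k then T i else id)"
  by (induction k) (auto simp: less_Suc_eq)

lemma mon_act_zero: "mon_act T k (\<lambda>_. 0) = id"
  by (induction k) auto

lemma (in vector_space) linear_mon_act:
  assumes "\<And>i. i < k \<Longrightarrow> Vector_Spaces.linear scale scale (T i)"
  shows "Vector_Spaces.linear scale scale (mon_act T k a)"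
  using assms
proof (induction k)
  case 0
  then show ?case by (simp add: linear_ident)
next
  case (Suc k)
  have "Vector_Spaces.linear scale scale (T k ^^ n)" for n
  proof (induction n)
    case (Suc n)
    have "Vector_Spaces.linear scale scale (T k)"
      by (rule \<open>\<And>i. i < Suc k \<Longrightarrow> Vector_Spaces.linear scale scale (T i)\<close>) simp
    with Suc show ?case
      unfolding funpow.simps by (rule Vector_Spaces.linear_compose)
  qed (simp add: linear_ident)
  moreover have "Vector_Spaces.linear scale scale (mon_act T k a)"
    by (rule Suc.IH, rule Suc.prems) simp
  ultimately show ?case
    unfolding mon_act.simps by (intro Vector_Spaces.linear_compose)
qed

section \<open>Standard monomials of a bigraded module\<close>

text \<open>The lexicographic order respects multiplication by a monomial;
  \<open>downset_std\<close> rests on this.\<close>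

lemma less_fun_add_right:
  fixes a b c :: "nat \<Rightarrow> nat"
  assumes "less_fun a b"
  shows "less_fun (\<lambda>i. a i + c i) (\<lambda>i. b i + c i)"
  using assms unfolding less_fun_def by auto

text \<open>Homogeneous generators are listed by index, so that each index carries its own bidegree
  even if vectors repeat.\<close>

locale bigraded_gens =
  fixes sc :: "'k::field \<Rightarrow> 'm::ab_group_add \<Rightarrow> 'm"
    and m :: nat and f :: "nat \<Rightarrow> nat \<times> nat"
    and T :: "nat \<Rightarrow> 'm \<Rightarrow> 'm" and Mg :: "int \<Rightarrow> int \<Rightarrow> 'm set"
    and r :: nat and g :: "nat \<Rightarrow> 'm" and e \<delta> :: "nat \<Rightarrow> int"
  assumes f1: "\<And>i. i < m \<Longrightarrow> fst (f i) = 1"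
    and bigr: "bigraded_module sc m f T Mg"
    and g_hom: "\<And>j. j < r \<Longrightarrow> g j \<in> Mg (e j) (\<delta> j)"
    and gen: "submodule_generated sc m T (g ` {..<r}) = UNIV"
begin

sublocale vector_space sc
  using bigr by (simp add: bigraded_module_def)

abbreviation w :: "nat \<Rightarrow> nat" where "w i \<equiv> snd (f i)"

definition vec :: "nat \<times> (nat \<Rightarrow> nat) \<Rightarrow> 'm" where
  "vec p = mon_act T m (snd p) (g (fst p))"

text \<open>Degrees are attached to the index, not to the vector: \<open>vec p\<close> may vanish or
  coincide with another, but for \<open>p\<close> in \<open>idx\<close> it lies in the component of
  bidegree \<open>(rdeg p, cdeg p)\<close>.\<close>

definition rdeg :: "nat \<times> (nat \<Rightarrow> nat) \<Rightarrow> int" where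
  "rdeg p = e (fst p) + int (mdeg m (snd p))"

definition cdeg :: "nat \<times> (nat \<Rightarrow> nat) \<Rightarrow> int" where
  "cdeg p = \<delta> (fst p) + int (mweight m w (snd p))"

definition idx :: "(nat \<times> (nat \<Rightarrow> nat)) set" where
  "idx = {..<r} \<times> monomials m"

text \<open>Larger second degree comes first, so that each step of the filtration is spanned by an
  initial segment of the index set.\<close>

definition prec :: "nat \<times> (nat \<Rightarrow> nat) \<Rightarrow> nat \<times> (nat \<Rightarrow> nat) \<Rightarrow> bool" where
  "prec p q \<longleftrightarrow> cdeg q < cdeg p \<or> (cdeg p = cdeg q
     \<and> (fst p < fst q \<or> (fst p = fst q \<and> less_fun (snd p) (snd q))))"

text \<open>Standard monomials in the sense of Groebner bases: the indices that do not lead any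
  relation within their row. Staying in one row keeps the set of predecessors finite.\<close>

definition std :: "(nat \<times> (nat \<Rightarrow> nat)) set" where
  "std = {p\<in>idx. vec p \<notin> span (vec ` {q\<in>idx. rdeg q = rdeg p \<and> prec q p})}"

definition std_row :: "int \<Rightarrow> (nat \<times> (nat \<Rightarrow> nat)) set" where
  "std_row n = {p\<in>std. rdeg p = n}"

lemma T_linear: "i < m \<Longrightarrow> Vector_Spaces.linear sc sc (T i)"
  and T_commute: "i < m \<Longrightarrow> j < m \<Longrightarrow> T i \<circ> T j = T j \<circ> T i"
  and Mg_subspace: "subspace (Mg n d)"
  and T_Mg: "i < m \<Longrightarrow> x \<in> Mg n d \<Longrightarrow> T i x \<in> Mg (n + 1) (d + int (w i))"
proof -
  show "i < m \<Longrightarrow> Vector_Spaces.linear sc sc (T i)" "i < m \<Longrightarrow> j < m \<Longrightarrow> T i \<circ> T j = T j \<circ> T i"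
    "subspace (Mg n d)"
    using bigr unfolding bigraded_module_def by simp_all
  have "\<forall>i<m. \<forall>n d. T i ` Mg n d \<subseteq> Mg (n + int (fst (f i))) (d + int (snd (f i)))"
    using bigr unfolding bigraded_module_def by simp
  then show "T i x \<in> Mg (n + 1) (d + int (w i))" if "i < m" "x \<in> Mg n d"
    using that f1[of i] by fastforce
qed

lemma decomposition_unique:
  assumes "finite {p. c p \<noteq> 0}" "\<And>p. c p \<in> Mg (fst p) (snd p)"
    and "finite {p. c' p \<noteq> 0}" "\<And>p. c' p \<in> Mg (fst p) (snd p)"
    and "(\<Sum>p\<in>{p. c p \<noteq> 0}. c p) = (\<Sum>p\<in>{p. c' p \<noteq> 0}. c' p)"
  shows "c = c'"
proof -
  have "\<exists>!c :: int \<times> int \<Rightarrow> 'm. finite {p. c p \<noteq> 0} \<and> (\<forall>p. c p \<in> Mg (fst p) (snd p))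
      \<and> (\<Sum>p\<in>{p. c' p \<noteq> 0}. c' p) = (\<Sum>p\<in>{p. c p \<noteq> 0}. c p)"
    using bigr[unfolded bigraded_module_def, THEN conjunct2, THEN conjunct2, THEN conjunct2,
        THEN conjunct2, THEN conjunct2] by (rule spec)
  moreover have "finite {p. c p \<noteq> 0} \<and> (\<forall>p. c p \<in> Mg (fst p) (snd p))
      \<and> (\<Sum>p\<in>{p. c' p \<noteq> 0}. c' p) = (\<Sum>p\<in>{p. c p \<noteq> 0}. c p)"
    using assms by (intro conjI allI) simp_all
  moreover have "finite {p. c' p \<noteq> 0} \<and> (\<forall>p. c' p \<in> Mg (fst p) (snd p))
      \<and> (\<Sum>p\<in>{p. c' p \<noteq> 0}. c' p) = (\<Sum>p\<in>{p. c' p \<noteq> 0}. c' p)"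
    using assms by (intro conjI allI) simp_all
  ultimately show ?thesis
    by (elim ex1E) (metis (lifting))
qed

section \<open>Spanning the rows and their filtration by monomial multiples of generators\<close>

lemma mon_act_Mg:
  assumes "k \<le> m" "x \<in> Mg n d"
  shows "mon_act T k a x \<in> Mg (n + int (mdeg k a)) (d + int (mweight k w a))"
  using assms(1)
proof (induction k)
  case 0
  then show ?case using assms by (simp add: mdeg_def mweight_def)
next
  case (Suc k)
  have pow: "(T k ^^ l) y \<in> Mg (n' + int l) (d' + int (w k * l))" if "y \<in> Mg n' d'" for l y n' d'
  proof (induction l)
    case (Suc l)
    then show ?case
      using T_Mg[OF _ Suc.IH, of k] \<open>Suc k \<le> m\<close> by (simp add: algebra_simps)
  qed (use that in simp)
  show ?case
    using pow[OF Suc.IH, of "a k"] Suc.prems by (simp add: mdeg_def mweight_def algebra_simps)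
qed

lemma vec_Mg: "p \<in> idx \<Longrightarrow> vec p \<in> Mg (rdeg p) (cdeg p)"
  unfolding vec_def rdeg_def cdeg_def by (rule mon_act_Mg) (auto simp: idx_def g_hom)

lemma mon_act_vec: "mon_act T m c (vec (j, a)) = vec (j, \<lambda>i. a i + c i)"
proof -
  have "mon_act T m (\<lambda>i. c i + a i) = mon_act T m c \<circ> mon_act T m a"
    by (rule mon_act_add) (rule T_commute)
  then show ?thesis
    by (simp add: vec_def fun_eq_iff add.commute)
qed

text \<open>The span contains the generators, as exponent 0, and is stable under each
  \<open>T i\<close>, which raises one exponent by 1.\<close>

lemma span_vec_idx: "span (vec ` idx) = UNIV"
proof -
  let ?S = "span (vec ` idx)"
  have "g j \<in> ?S" if "j < r" for j
  proof -
    have "g j = vec (j, \<lambda>_. 0)"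
      by (simp add: vec_def mon_act_zero)
    moreover have "(j, \<lambda>_. 0) \<in> idx"
      using that by (simp add: idx_def monomials_def)
    ultimately show ?thesis
      by (auto intro: span_base)
  qed
  moreover have "T i ` ?S \<subseteq> ?S" if i: "i < m" for i
  proof -
    interpret Ti: Vector_Spaces.linear sc sc "T i"
      by (rule T_linear[OF i])
    have "T i (vec p) \<in> ?S" if p: "p \<in> idx" for p
    proof -
      have "T i (vec p) = vec (fst p, \<lambda>l. snd p l + (if l = i then 1 else 0))"
        using mon_act_vec[of "\<lambda>l. if l = i then 1 else 0" "fst p" "snd p"] i
        by (simp only: mon_act_single prod.collapse if_True)
      moreover have "(fst p, \<lambda>l. snd p l + (if l = i then 1 else 0)) \<in> idx"
        using p i by (auto simp: idx_def monomials_def)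
      ultimately show ?thesis
        by (auto intro: span_base)
    qed
    then have "T i ` (vec ` idx) \<subseteq> ?S"
      by auto
    then have "span (T i ` (vec ` idx)) \<subseteq> ?S"
      by (rule span_minimal) (rule subspace_span)
    then show ?thesis
      by (simp add: Ti.span_image)
  qed
  ultimately have "submodule_generated sc m T (g ` {..<r}) \<subseteq> ?S"
    unfolding submodule_generated_def by (intro Inter_lower) (auto simp: subspace_span)
  then show ?thesis
    using gen by auto
qed

text \<open>Write \<open>x\<close> as a combination of the \<open>vec p\<close> and collect terms of
  equal bidegree. Uniqueness of the homogeneous decomposition forces the part of bidegree
  \<open>(n, d)\<close> to be all of \<open>x\<close>.\<close>

lemma Mg_spanned:
  assumes x: "x \<in> Mg n d"
  shows "x \<in> span (vec ` {p\<in>idx. rdeg p = n \<and> cdeg p = d})"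
proof -
  have "x \<in> span (vec ` idx)"
    by (simp add: span_vec_idx)
  then obtain t u where t: "finite t" "t \<subseteq> vec ` idx" "x = (\<Sum>a\<in>t. sc (u a) a)"
    by (auto simp: span_explicit)
  from t(2) have "\<forall>a\<in>t. \<exists>q\<in>idx. vec q = a"
    by auto
  then obtain q where q: "\<And>a. a \<in> t \<Longrightarrow> q a \<in> idx" "\<And>a. a \<in> t \<Longrightarrow> vec (q a) = a"
    by metis
  define b where "b a = (rdeg (q a), cdeg (q a))" for a
  define c where "c p = (\<Sum>a\<in>{a\<in>t. b a = p}. sc (u a) a)" for p
  define c' where "c' p = (if p = (n, d) then x else 0)" for p
  have supp: "{p. c p \<noteq> 0} \<subseteq> b ` t"
  proof
    fix p assume "p \<in> {p. c p \<noteq> 0}"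
    then have "(\<Sum>a\<in>{a\<in>t. b a = p}. sc (u a) a) \<noteq> 0"
      by (simp add: c_def)
    then obtain a where "a \<in> {a\<in>t. b a = p}"
      by (rule sum.not_neutral_contains_not_neutral)
    then show "p \<in> b ` t" by auto
  qed
  have c_span: "c p \<in> span (vec ` {q\<in>idx. rdeg q = fst p \<and> cdeg q = snd p})" for p
    unfolding c_def
  proof (intro span_sum span_scale span_base)
    fix a assume "a \<in> {a\<in>t. b a = p}"
    then show "a \<in> vec ` {q\<in>idx. rdeg q = fst p \<and> cdeg q = snd p}"
      using q by (intro image_eqI[of _ _ "q a"]) (auto simp: b_def)
  qed
  have "c = c'"
  proof (rule decomposition_unique)
    show "finite {p. c p \<noteq> 0}"
      using supp t(1) by (blast intro: finite_subset)
    show "c p \<in> Mg (fst p) (snd p)" for p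
    proof -
      have "span (vec ` {q\<in>idx. rdeg q = fst p \<and> cdeg q = snd p}) \<subseteq> Mg (fst p) (snd p)"
      proof (intro span_minimal Mg_subspace image_subsetI)
        fix q assume "q \<in> {q\<in>idx. rdeg q = fst p \<and> cdeg q = snd p}"
        then show "vec q \<in> Mg (fst p) (snd p)"
          using vec_Mg[of q] by simp
      qed
      then show ?thesis using c_span by blast
    qed
    have "{p. c' p \<noteq> 0} \<subseteq> {(n, d)}"
      by (auto simp: c'_def)
    then show "finite {p. c' p \<noteq> 0}"
      by (rule finite_subset) simp
    show "c' p \<in> Mg (fst p) (snd p)" for p
      using x subspace_0[OF Mg_subspace] by (auto simp: c'_def)
    have "(\<Sum>p\<in>{p. c p \<noteq> 0}. c p) = (\<Sum>p\<in>b ` t. c p)"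
      using supp t(1) by (intro sum.mono_neutral_left) auto
    also have "\<dots> = x"
      unfolding c_def t(3) using t(1) by (intro sum.group) auto
    also have "x = (\<Sum>p\<in>{(n, d)}. c' p)"
      by (simp add: c'_def)
    also have "\<dots> = (\<Sum>p\<in>{p. c' p \<noteq> 0}. c' p)"
      by (intro sum.mono_neutral_right) (auto simp: c'_def)
    finally show "(\<Sum>p\<in>{p. c p \<noteq> 0}. c p) = (\<Sum>p\<in>{p. c' p \<noteq> 0}. c' p)" .
  qed
  then have "c (n, d) = x"
    by (simp add: c'_def)
  then show ?thesis
    using c_span[of "(n, d)"] by simp
qed

lemma row_filt_eq_span:
  "row_filt sc Mg n lam = span (vec ` {p\<in>idx. rdeg p = n \<and> lam \<le> real_of_int (cdeg p)})"
  (is "_ = span (vec ` ?I)")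
proof -
  have "Mg n d \<subseteq> span (vec ` ?I)" if "lam \<le> real_of_int d" for d
  proof
    fix x assume "x \<in> Mg n d"
    then have "x \<in> span (vec ` {p\<in>idx. rdeg p = n \<and> cdeg p = d})"
      by (rule Mg_spanned)
    also have "\<dots> \<subseteq> span (vec ` ?I)"
      using that by (intro span_mono) auto
    finally show "x \<in> span (vec ` ?I)" .
  qed
  then have "row_filt sc Mg n lam \<subseteq> span (vec ` ?I)"
    unfolding row_filt_def by (intro span_minimal) (auto simp: subspace_span)
  moreover have "vec ` ?I \<subseteq> (\<Union>d\<in>{d. lam \<le> real_of_int d}. Mg n d)"
    using vec_Mg by fastforce
  then have "span (vec ` ?I) \<subseteq> row_filt sc Mg n lam"
    unfolding row_filt_def by (rule span_mono)
  ultimately show ?thesis by blast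
qed

lemma row_space_eq_span: "row_space sc Mg n = span (vec ` {p\<in>idx. rdeg p = n})"
  (is "_ = span (vec ` ?I)")
proof -
  have "Mg n d \<subseteq> span (vec ` ?I)" for d
  proof
    fix x assume "x \<in> Mg n d"
    then have "x \<in> span (vec ` {p\<in>idx. rdeg p = n \<and> cdeg p = d})"
      by (rule Mg_spanned)
    also have "\<dots> \<subseteq> span (vec ` ?I)"
      by (intro span_mono) auto
    finally show "x \<in> span (vec ` ?I)" .
  qed
  then have "row_space sc Mg n \<subseteq> span (vec ` ?I)"
    unfolding row_space_def by (intro span_minimal) (auto simp: subspace_span)
  moreover have "vec ` ?I \<subseteq> (\<Union>d. Mg n d)"
    using vec_Mg by fastforce
  then have "span (vec ` ?I) \<subseteq> row_space sc Mg n"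
    unfolding row_space_def by (rule span_mono)
  ultimately show ?thesis by blast
qed

section \<open>Dimensions as numbers of standard monomials\<close>

lemma finite_idx_row: "finite {p\<in>idx. rdeg p = n}"
proof (rule finite_subset)
  show "{p\<in>idx. rdeg p = n}
      \<subseteq> Sigma {..<r} (\<lambda>j. {a \<in> monomials m. mdeg m a = nat (n - e j)})"
    by (auto simp: idx_def rdeg_def)
qed (auto intro: finite_monomials_of_degree)

lemma prec_asymp: "asymp_on A prec"
  by (rule asymp_onI) (auto simp: prec_def dest: less_fun_asym)

lemma prec_transp: "transp_on A prec"
  by (rule transp_onI) (auto simp: prec_def intro: less_fun_trans)

lemma prec_totalp: "A \<subseteq> idx \<Longrightarrow> totalp_on A prec"
proof (rule totalp_onI)
  fix p q assume "A \<subseteq> idx" "p \<in> A" "q \<in> A" and ne: "p \<noteq> q"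
  then have "snd p \<in> monomials m" "snd q \<in> monomials m"
    by (auto simp: idx_def)
  then have "snd p i = snd q i" if "i \<notin> {..<m}" for i
    using that by (simp add: monomials_def)
  \<comment> \<open>Trichotomy of \<open>less_fun\<close> requires two functions differing at only
    finitely many places.\<close>
  then have "{i. snd p i \<noteq> snd q i} \<subseteq> {..<m}"
    by blast
  then have "finite {i. snd p i \<noteq> snd q i}"
    by (rule finite_subset) simp
  then have "less_fun (snd p) (snd q) \<or> snd p = snd q \<or> less_fun (snd q) (snd p)"
    by (rule less_fun_trichotomy)
  then show "prec p q \<or> prec q p"
    using ne by (auto simp: prec_def prod_eq_iff)
qed

text \<open>For an initial segment the predecessors inside \<open>I\<close> are all predecessors in
  the row, so being standard relative to \<open>I\<close> and being standard in the row agree. One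
  set \<open>std_row n\<close> thus gives bases of all these spans at once.\<close>

lemma dim_span_initial_segment:
  assumes I: "I \<subseteq> {p\<in>idx. rdeg p = n}"
    and seg: "\<And>p q. p \<in> I \<Longrightarrow> q \<in> idx \<Longrightarrow> rdeg q = n \<Longrightarrow> prec q p \<Longrightarrow> q \<in> I"
  shows "dim (span (vec ` I)) = card (I \<inter> std_row n)"
    and "span (vec ` (I \<inter> std_row n)) = span (vec ` I)"
proof -
  have S: "{i\<in>I. vec i \<notin> span (vec ` {j\<in>I. prec j i})} = I \<inter> std_row n"
  proof -
    have "{j\<in>I. prec j i} = {q\<in>idx. rdeg q = rdeg i \<and> prec q i}" if "i \<in> I" for i
      using I seg[OF that] that by auto
    then show ?thesis
      using I by (auto simp: std_row_def std_def)
  qed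
  have fin: "finite I"
    using I finite_idx_row by (rule finite_subset)
  have "I \<subseteq> idx"
    using I by blast
  note * = standard_indices_basis[OF fin prec_asymp prec_transp prec_totalp[OF this], of vec,
      unfolded S]
  show "span (vec ` (I \<inter> std_row n)) = span (vec ` I)"
    using * by blast
  then have "dim (span (vec ` I)) = dim (vec ` (I \<inter> std_row n))"
    using dim_span[of "vec ` (I \<inter> std_row n)"] by simp
  also have "\<dots> = card (vec ` (I \<inter> std_row n))"
    using * by (intro dim_eq_card_independent) blast
  also have "\<dots> = card (I \<inter> std_row n)"
    using * by (intro card_image) blast
  finally show "dim (span (vec ` I)) = card (I \<inter> std_row n)" .
qed

lemma std_row_subset: "std_row n \<subseteq> {p\<in>idx. rdeg p = n}"
  by (auto simp: std_row_def std_def)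

lemma finite_std_row: "finite (std_row n)"
  using std_row_subset finite_idx_row by (rule finite_subset)

lemma dim_row_filt:
  "dim (row_filt sc Mg n lam) = card {p\<in>std_row n. lam \<le> real_of_int (cdeg p)}"
proof -
  let ?I = "{p\<in>idx. rdeg p = n \<and> lam \<le> real_of_int (cdeg p)}"
  have "dim (span (vec ` ?I)) = card (?I \<inter> std_row n)"
    by (rule dim_span_initial_segment) (auto simp: prec_def)
  also have "?I \<inter> std_row n = {p\<in>std_row n. lam \<le> real_of_int (cdeg p)}"
    using std_row_subset by blast
  finally show ?thesis
    unfolding row_filt_eq_span .
qed

lemma dim_row_space: "dim (row_space sc Mg n) = card (std_row n)"
  and row_space_eq_span_std: "row_space sc Mg n = span (vec ` std_row n)"
proof -
  let ?I = "{p\<in>idx. rdeg p = n}"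
  have *: "dim (span (vec ` ?I)) = card (?I \<inter> std_row n)"
    "span (vec ` (?I \<inter> std_row n)) = span (vec ` ?I)"
    by (rule dim_span_initial_segment; auto)+
  moreover have "?I \<inter> std_row n = std_row n"
    using std_row_subset by blast
  ultimately show "dim (row_space sc Mg n) = card (std_row n)"
    "row_space sc Mg n = span (vec ` std_row n)"
    unfolding row_space_eq_span by simp_all
qed

text \<open>If \<open>vec (j, a)\<close> were a combination of smaller vectors, applying the
  monomial with exponent \<open>b - a\<close> would express \<open>vec (j, b)\<close> by smaller
  ones, since the order is preserved.\<close>

lemma downset_std:
  assumes "j < r"
  shows "downset m {a. (j, a) \<in> std}"
  unfolding downset_def
proof (intro conjI ballI allI impI)
  show "{a. (j, a) \<in> std} \<subseteq> monomials m"
    by (auto simp: std_def idx_def)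
next
  fix b a assume b: "b \<in> {a. (j, a) \<in> std}" and le: "\<forall>i. a i \<le> b i"
  define c where "c i = b i - a i" for i
  define sh where "sh q = (fst q, \<lambda>i. snd q i + c i)" for q :: "nat \<times> (nat \<Rightarrow> nat)"
  have b_eq: "(j, b) = sh (j, a)"
    using le by (auto simp: sh_def c_def)
  have b_idx: "(j, b) \<in> idx" and b_std: "vec (j, b) \<notin> span (vec ` {q\<in>idx. rdeg q = rdeg (j, b) \<and> prec q (j, b)})"
    using b by (auto simp: std_def)
  have c_mon: "c \<in> monomials m" and a_idx: "(j, a) \<in> idx"
    using b_idx le by (auto simp: idx_def monomials_def c_def) (metis le_zero_eq)
  have rdeg_sh: "rdeg (sh q) = rdeg q + int (mdeg m c)" for q
    by (simp add: rdeg_def sh_def mdeg_def sum.distrib)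
  have cdeg_sh: "cdeg (sh q) = cdeg q + int (mweight m w c)" for q
    by (simp add: cdeg_def sh_def mweight_def sum.distrib algebra_simps)
  have prec_sh: "prec (sh p) (sh q)" if "prec p q" for p q
    using that less_fun_add_right[of "snd p" "snd q" c]
    unfolding prec_def cdeg_sh by (auto simp: sh_def)
  have vec_sh: "mon_act T m c (vec q) = vec (sh q)" for q
    using mon_act_vec[of c "fst q" "snd q"] by (simp add: sh_def)
  interpret A: Vector_Spaces.linear sc sc "mon_act T m c"
    by (rule linear_mon_act) (rule T_linear)
  let ?L = "\<lambda>p. {q\<in>idx. rdeg q = rdeg p \<and> prec q p}"
  have "vec (j, a) \<notin> span (vec ` ?L (j, a))"
  proof
    assume "vec (j, a) \<in> span (vec ` ?L (j, a))"
    then have "mon_act T m c (vec (j, a)) \<in> span (mon_act T m c ` vec ` ?L (j, a))"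
      unfolding A.span_image by blast
    also have "mon_act T m c ` vec ` ?L (j, a) \<subseteq> vec ` ?L (j, b)"
    proof (intro subsetI; elim imageE)
      fix x y q assume "x = mon_act T m c y" "y = vec q" and q: "q \<in> ?L (j, a)"
      then have "x = vec (sh q)"
        by (simp add: vec_sh)
      moreover have "sh q \<in> ?L (j, b)"
        using q c_mon unfolding b_eq
        by (auto simp: rdeg_sh prec_sh) (auto simp: idx_def sh_def monomials_def)
      ultimately show "x \<in> vec ` ?L (j, b)" by blast
    qed
    then have "span (mon_act T m c ` vec ` ?L (j, a)) \<subseteq> span (vec ` ?L (j, b))"
      by (rule span_mono)
    finally show False
      using b_std by (simp add: vec_sh b_eq)
  qed
  then show "a \<in> {a. (j, a) \<in> std}"
    using a_idx by (simp add: std_def)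
qed

section \<open>Power sums and growth of the second degrees\<close>

lemma eventually_poly_std_row:
  "eventually_poly (\<lambda>n. \<Sum>p\<in>std_row (int n). real_of_int (cdeg p) ^ k)"
proof -
  let ?D = "\<lambda>j. {a. (j, a) \<in> std}"
  have eq: "(\<Sum>p\<in>std_row (int n). real_of_int (cdeg p) ^ k)
      = (\<Sum>j<r. power_sum m w (?D j) (of_int (\<delta> j)) k (nat (int n - e j)))"
    \<comment> \<open>Beyond every \<open>e j\<close> the difference \<open>int n - e j\<close> is
      not truncated; the inserted 0 keeps \<open>Max\<close> meaningful when there are no
      generators.\<close>
    if n: "n \<ge> nat (Max (insert 0 (e ` {..<r})))" for n
  proof -
    have e_le: "e j \<le> int n" if "j < r" for j
    proof -
      have "e j \<le> Max (insert 0 (e ` {..<r}))"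
        using that by (intro Max_ge) auto
      then show ?thesis using n by linarith
    qed
    let ?A = "\<lambda>j. {a \<in> ?D j. mdeg m a = nat (int n - e j)}"
    have "std_row (int n) = Sigma {..<r} ?A"
      using e_le by (auto simp: std_row_def std_def idx_def rdeg_def)
    then have "(\<Sum>p\<in>std_row (int n). real_of_int (cdeg p) ^ k)
        = (\<Sum>(j, a)\<in>Sigma {..<r} ?A. real_of_int (cdeg (j, a)) ^ k)"
      by (simp add: case_prod_unfold)
    also have "\<dots> = (\<Sum>j<r. \<Sum>a\<in>?A j. real_of_int (cdeg (j, a)) ^ k)"
    proof (rule sum.Sigma[symmetric])
      show "\<forall>j\<in>{..<r}. finite (?A j)"
        using downset_std
        by (intro ballI finite_subset[OF _ finite_monomials_of_degree]) (auto simp: downset_def)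
    qed simp
    finally show ?thesis
      by (simp add: power_sum_def cdeg_def)
  qed
  have "\<forall>\<^sub>F n in sequentially.
      (\<Sum>j<r. power_sum m w (?D j) (of_int (\<delta> j)) k (nat (int n - e j)))
      = (\<Sum>p\<in>std_row (int n). real_of_int (cdeg p) ^ k)"
    using eventually_ge_at_top[of "nat (Max (insert 0 (e ` {..<r})))"]
    by eventually_elim (rule eq[symmetric])
  moreover have "eventually_poly (\<lambda>n. \<Sum>j<r. power_sum m w (?D j) (of_int (\<delta> j)) k (nat (int n - e j)))"
    by (intro eventually_poly_sum eventually_poly_shift eventually_poly_power_sum downset_std) simp
  ultimately show ?thesis
    by (rule eventually_poly_cong)
qed

text \<open>As each variable has first degree 1, the total degree of the monomial is
  \<open>n - e j\<close>; the weight is at most \<open>W\<close> times that, and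
  \<open>n \<ge> 1\<close> absorbs the constants.\<close>

lemma cdeg_linear_bound:
  "\<exists>C>0. \<forall>n\<ge>1. \<forall>p\<in>std_row (int n). \<bar>real_of_int (cdeg p)\<bar> \<le> C * real n"
proof -
  define E where "E = (\<Sum>j<r. \<bar>e j\<bar>)"
  define \<Delta> where "\<Delta> = (\<Sum>j<r. \<bar>\<delta> j\<bar>)"
  define W where "W = (\<Sum>i<m. w i)"
  have bound: "\<bar>cdeg p\<bar> \<le> (\<Delta> + int W * (E + 1)) * int n" if "n \<ge> 1" "p \<in> std_row (int n)" for n p
  proof -
    obtain j a where p: "p = (j, a)" by (cases p)
    have j: "j < r" and deg: "e j + int (mdeg m a) = int n"
      using that std_row_subset[of "int n"] by (auto simp: p idx_def rdeg_def)
    have E: "\<bar>e j\<bar> \<le> E" and D: "\<bar>\<delta> j\<bar> \<le> \<Delta>"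
      using j unfolding E_def \<Delta>_def by (auto intro: member_le_sum)
    have "mweight m w a \<le> (\<Sum>i<m. W * a i)"
      unfolding mweight_def W_def by (intro sum_mono mult_right_mono member_le_sum) auto
    also have "\<dots> = W * mdeg m a"
      by (simp add: mdeg_def sum_distrib_left)
    finally have "int (mweight m w a) \<le> int W * int (mdeg m a)"
      by (metis of_nat_le_iff of_nat_mult)
    also have "int (mdeg m a) \<le> E * int n + int n"
    proof -
      have "int (mdeg m a) \<le> E + int n"
        using deg E by linarith
      also have "E \<le> E * int n"
        using that(1) E mult_left_mono[of 1 "int n" E] by simp
      finally show ?thesis by simp
    qed
    then have "int W * int (mdeg m a) \<le> int W * (E * int n + int n)"
      by (rule mult_left_mono) simp
    finally have 1: "int (mweight m w a) \<le> int W * (E * int n + int n)" .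
    have "\<Delta> \<le> \<Delta> * int n"
      using that(1) D mult_left_mono[of 1 "int n" \<Delta>] by simp
    then show ?thesis
      using 1 D by (simp add: p cdeg_def algebra_simps)
  qed
  \<comment> \<open>The added 1 makes the constant strictly positive.\<close>
  define C where "C = real_of_int (\<Delta> + int W * (E + 1)) + 1"
  have "E \<ge> 0" "\<Delta> \<ge> 0"
    by (auto simp: E_def \<Delta>_def intro: sum_nonneg)
  then have "C > 0"
    by (simp add: C_def add_nonneg_pos)
  moreover have "\<bar>real_of_int (cdeg p)\<bar> \<le> C * real n" if "n \<ge> 1" "p \<in> std_row (int n)" for n p
  proof -
    have "real_of_int \<bar>cdeg p\<bar> \<le> real_of_int ((\<Delta> + int W * (E + 1)) * int n)"
      using bound[OF that] by (simp only: of_int_le_iff)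
    also have "\<dots> \<le> C * real n"
      by (simp add: C_def algebra_simps)
    finally show ?thesis by simp
  qed
  ultimately show ?thesis by blast
qed

end

section \<open>Passing to homogeneous generators\<close>

text \<open>Each generator is replaced by its finitely many nonzero homogeneous components, whose
  sum recovers it.\<close>

lemma bigraded_gens_exist:
  assumes f1: "\<forall>i<m. fst (f i) = 1"
    and bigr: "bigraded_module sc m f T Mg"
    and fg: "finitely_generated_module sc m T"
  shows "\<exists>r g e \<delta>. bigraded_gens sc m f T Mg r g e \<delta>"
proof -
  interpret vector_space sc
    using bigr by (simp add: bigraded_module_def)
  obtain G where G: "finite G" "submodule_generated sc m T G = UNIV"
    using fg by (auto simp: finitely_generated_module_def)
  have "\<forall>x. \<exists>c :: int \<times> int \<Rightarrow> 'b. finite {p. c p \<noteq> 0}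
          \<and> (\<forall>p. c p \<in> Mg (fst p) (snd p)) \<and> x = (\<Sum>p\<in>{p. c p \<noteq> 0}. c p)"
    using bigr[unfolded bigraded_module_def, THEN conjunct2, THEN conjunct2, THEN conjunct2,
        THEN conjunct2, THEN conjunct2] by (intro allI ex1_implies_ex) (rule spec)
  from choice[OF this] obtain c :: "'b \<Rightarrow> int \<times> int \<Rightarrow> 'b" where
    "\<forall>x. finite {p. c x p \<noteq> 0} \<and> (\<forall>p. c x p \<in> Mg (fst p) (snd p)) \<and> x = (\<Sum>p\<in>{p. c x p \<noteq> 0}. c x p)"
    by (elim exE)
  then have c: "\<And>x. finite {p. c x p \<noteq> 0}" "\<And>x p. c x p \<in> Mg (fst p) (snd p)"
      "\<And>x. x = (\<Sum>p\<in>{p. c x p \<noteq> 0}. c x p)"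
    by auto
  \<comment> \<open>Components are stored with their bidegree, so that the enumeration
    \<open>h\<close> returns both.\<close>
  define H where "H = (\<Union>x\<in>G. (\<lambda>p. (p, c x p)) ` {p. c x p \<noteq> 0})"
  have "finite H"
    using G(1) c(1) by (simp add: H_def)
  then obtain r :: nat and h :: "nat \<Rightarrow> (int \<times> int) \<times> 'b" where h: "H = h ` {i. i < r}"
    using finite_imp_nat_seg_image_inj_on[of H] by blast
  define g where "g j = snd (h j)" for j
  have "submodule_generated sc m T (g ` {..<r}) = UNIV"
  proof -
    have "G \<subseteq> S" if S: "subspace S" "g ` {..<r} \<subseteq> S" for S
    proof
      fix x assume x: "x \<in> G"
      have "c x p \<in> S" if "c x p \<noteq> 0" for p
      proof -
        have "(p, c x p) \<in> H"
          using x that by (auto simp: H_def)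
        then obtain i where "i < r" "h i = (p, c x p)"
          by (auto simp: h)
        then have "c x p = g i" by (simp add: g_def)
        then show ?thesis
          using S \<open>i < r\<close> by auto
      qed
      then have "(\<Sum>p\<in>{p. c x p \<noteq> 0}. c x p) \<in> S"
        using S(1) by (intro subspace_sum) auto
      then show "x \<in> S"
        using c(3)[of x] by simp
    qed
    then have "submodule_generated sc m T G \<subseteq> submodule_generated sc m T (g ` {..<r})"
      unfolding submodule_generated_def by (intro Inter_anti_mono) blast
    then show ?thesis
      using G(2) by auto
  qed
  moreover have "g j \<in> Mg (fst (fst (h j))) (snd (fst (h j)))" if "j < r" for j
  proof -
    have "h j \<in> H" using that h by auto
    then show ?thesis
      using c(2) by (auto simp: H_def g_def)
  qed
  ultimately have "bigraded_gens sc m f T Mg r g (\<lambda>j. fst (fst (h j))) (\<lambda>j. snd (fst (h j)))"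
    using f1 bigr by unfold_locales auto
  then show ?thesis by blast
qed

section \<open>Quotients of eventually polynomial sequences\<close>

text \<open>\<open>d\<close> may exceed the degree, the limit then being 0; so two polynomials can
  be normalised by a common power.\<close>

lemma poly_over_power_tendsto:
  fixes p :: "real poly"
  assumes "degree p \<le> d"
  shows "(\<lambda>n. poly p (real n) / real n ^ d) \<longlonglongrightarrow> coeff p d"
proof -
  have "(\<lambda>n. \<Sum>i\<le>d. coeff p i * (real n ^ i / real n ^ d))
      \<longlonglongrightarrow> (\<Sum>i\<le>d. coeff p i * (if i = d then 1 else 0))"
  proof (intro tendsto_sum tendsto_mult tendsto_const)
    fix i assume i: "i \<in> {..d}"
    show "(\<lambda>n. real n ^ i / real n ^ d) \<longlonglongrightarrow> (if i = d then 1 else 0)"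
    proof (cases "i = d")
      case True
      have "\<forall>\<^sub>F n in sequentially. 1 = real n ^ i / real n ^ d"
        using eventually_gt_at_top[of "0::nat"] by eventually_elim (simp add: True)
      then show ?thesis
        using True by (auto intro: tendsto_eventually elim: eventually_mono)
    next
      case False
      have "\<forall>\<^sub>F n in sequentially. inverse (real n) ^ (d - i) = real n ^ i / real n ^ d"
        using eventually_gt_at_top[of "0::nat"]
        by eventually_elim (use i in \<open>simp add: power_diff field_simps\<close>)
      moreover have "(\<lambda>n. inverse (real n) ^ (d - i)) \<longlonglongrightarrow> 0 ^ (d - i)"
        by (intro tendsto_power lim_inverse_n)
      ultimately show ?thesis
        using False i by (auto simp: zero_power elim: Lim_transform_eventually[rotated])
    qed
  qed
  moreover have "poly p x = (\<Sum>i\<le>d. coeff p i * x ^ i)" for x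
    unfolding poly_altdef using assms
    by (intro sum.mono_neutral_left) (auto simp: coeff_eq_0)
  moreover have "(\<Sum>i\<le>d. coeff p i * (if i = d then 1 else 0)) = (\<Sum>i\<le>d. if i = d then coeff p i else 0)"
    by (intro sum.cong) auto
  ultimately show ?thesis
    by (simp add: sum_divide_distrib)
qed

lemma poly_eventually_nonzero:
  fixes p :: "real poly"
  assumes "p \<noteq> 0"
  shows "\<forall>\<^sub>F n in sequentially. poly p (real n) \<noteq> 0"
proof -
  have "\<forall>\<^sub>F n in sequentially. poly p (real n) / real n ^ degree p \<noteq> 0"
    by (rule tendsto_imp_eventually_ne[OF poly_over_power_tendsto]) (use assms in auto)
  then show ?thesis
    by eventually_elim auto
qed

lemma eventually_poly_power_mult:
  assumes "eventually_poly p"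
  shows "eventually_poly (\<lambda>n. real n ^ k * p n)"
proof -
  from assms obtain P where "\<forall>\<^sub>F n in sequentially. p n = poly P (real n)"
    by (auto simp: eventually_poly_def)
  then have "\<forall>\<^sub>F n in sequentially. real n ^ k * p n = poly (monom 1 k * P) (real n)"
    by eventually_elim (simp add: poly_monom)
  then show ?thesis
    unfolding eventually_poly_def by blast
qed

text \<open>Boundedness of the quotient forces the degree of the numerator to be at most that of the
  denominator.\<close>

lemma eventually_poly_quotient_convergent:
  assumes a: "eventually_poly a" and b: "eventually_poly b"
    and nz: "\<forall>\<^sub>F n in sequentially. b n \<noteq> 0"
    and le: "\<forall>\<^sub>F n in sequentially. \<bar>a n\<bar> \<le> K * \<bar>b n\<bar>"
  shows "convergent (\<lambda>n. a n / b n)"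
proof -
  obtain A where A: "\<forall>\<^sub>F n in sequentially. a n = poly A (real n)"
    using a by (auto simp: eventually_poly_def)
  obtain B where B: "\<forall>\<^sub>F n in sequentially. b n = poly B (real n)"
    using b by (auto simp: eventually_poly_def)
  define d where "d = max (degree A) (degree B)"
  have limA: "(\<lambda>n. a n / real n ^ d) \<longlonglongrightarrow> coeff A d"
    by (rule Lim_transform_eventually[OF poly_over_power_tendsto[of A d]])
       (use A in \<open>auto simp: d_def elim: eventually_mono\<close>)
  have limB: "(\<lambda>n. b n / real n ^ d) \<longlonglongrightarrow> coeff B d"
    by (rule Lim_transform_eventually[OF poly_over_power_tendsto[of B d]])
       (use B in \<open>auto simp: d_def elim: eventually_mono\<close>)
  have "B \<noteq> 0"
  proof
    assume "B = 0"
    have "\<forall>\<^sub>F n in sequentially. b n = 0"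
      using B by eventually_elim (simp add: \<open>B = 0\<close>)
    with nz have "eventually (\<lambda>n. False) sequentially"
      by eventually_elim simp
    then show False by simp
  qed
  have "\<bar>coeff A d\<bar> \<le> K * \<bar>coeff B d\<bar>"
  proof (rule tendsto_le)
    show "(\<lambda>n. \<bar>a n / real n ^ d\<bar>) \<longlonglongrightarrow> \<bar>coeff A d\<bar>"
      using limA by (rule tendsto_rabs)
    show "(\<lambda>n. K * \<bar>b n / real n ^ d\<bar>) \<longlonglongrightarrow> K * \<bar>coeff B d\<bar>"
      using limB by (intro tendsto_mult tendsto_const tendsto_rabs)
    show "\<forall>\<^sub>F n in sequentially. \<bar>a n / real n ^ d\<bar> \<le> K * \<bar>b n / real n ^ d\<bar>"
      using le by eventually_elim (auto simp: abs_divide intro: divide_right_mono)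
  qed simp
  then have "coeff B d \<noteq> 0"
    using \<open>B \<noteq> 0\<close> unfolding d_def
    by (cases "degree A \<le> degree B") (auto simp: max_def coeff_eq_0)
  then have "(\<lambda>n. (a n / real n ^ d) / (b n / real n ^ d)) \<longlonglongrightarrow> coeff A d / coeff B d"
    by (intro tendsto_divide limA limB)
  moreover have "\<forall>\<^sub>F n in sequentially. (a n / real n ^ d) / (b n / real n ^ d) = a n / b n"
    using eventually_gt_at_top[of "0::nat"] by eventually_elim simp
  ultimately show ?thesis
    by (intro convergentI) (rule Lim_transform_eventually)
qed

section \<open>Convergence of moments implies weak convergence\<close>

text \<open>No limit is known in advance, so the Cauchy criterion is verified by a three-term
  estimate.\<close>

lemma convergent_of_uniform_approx:
  fixes x :: "nat \<Rightarrow> real"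
  assumes "\<And>\<epsilon>. \<epsilon> > 0 \<Longrightarrow> \<exists>y. convergent y \<and> (\<forall>n. \<bar>x n - y n\<bar> \<le> \<epsilon>)"
  shows "convergent x"
proof -
  have "Cauchy x"
  proof (rule CauchyI)
    fix \<epsilon> :: real assume "\<epsilon> > 0"
    then obtain y where y: "convergent y" "\<And>n. \<bar>x n - y n\<bar> \<le> \<epsilon> / 4"
      using assms[of "\<epsilon> / 4"] by auto
    then obtain M where M: "\<And>i j. i \<ge> M \<Longrightarrow> j \<ge> M \<Longrightarrow> norm (y i - y j) < \<epsilon> / 4"
      using \<open>\<epsilon> > 0\<close> CauchyD[OF convergent_Cauchy, of y "\<epsilon> / 4"] by auto
    have "norm (x i - x j) < \<epsilon>" if "i \<ge> M" "j \<ge> M" for i j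
      using M[OF that] y(2)[of i] y(2)[of j] \<open>\<epsilon> > 0\<close> unfolding real_norm_def by linarith
    then show "\<exists>M. \<forall>m\<ge>M. \<forall>n\<ge>M. norm (x m - x n) < \<epsilon>" by blast
  qed
  then show ?thesis
    by (simp add: Cauchy_convergent_iff)
qed

lemma (in real_distribution) integrable_continuous_of_bounded_support:
  fixes f :: "real \<Rightarrow> real"
  assumes "AE x in M. \<bar>x\<bar> \<le> C" "continuous_on UNIV f"
  shows "integrable M f"
proof -
  have "compact (f ` {-C..C})"
    using assms(2) by (intro compact_continuous_image) (auto intro: continuous_on_subset)
  then obtain B where B: "\<And>x. x \<in> {-C..C} \<Longrightarrow> norm (f x) \<le> B"
    using compact_imp_bounded bounded_iff by (metis (no_types, lifting) imageI)
  have "AE x in M. norm (f x) \<le> B"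
    using assms(1) by eventually_elim (rule B, auto)
  moreover have "f \<in> borel_measurable M"
    unfolding measurable_cong_sets[OF events_eq_borel refl]
    using assms(2) by (rule borel_measurable_continuous_onI)
  ultimately show ?thesis
    by (rule integrable_const_bound)
qed

text \<open>Integrals of polynomials are combinations of moments. By Weierstrass \<open>f\<close> is
  within \<epsilon> of a polynomial on \<open>{-C..C}\<close>, which carries every
  \<open>\<mu> n\<close>, so the integrals differ by at most \<epsilon> uniformly in
  \<open>n\<close>.\<close>

lemma convergent_integral_of_moments:
  fixes \<mu> :: "nat \<Rightarrow> real measure" and f :: "real \<Rightarrow> real"
  assumes \<mu>: "\<And>n. real_distribution (\<mu> n)"
    and supp: "\<And>n. AE x in \<mu> n. \<bar>x\<bar> \<le> C"
    and mom: "\<And>k. convergent (\<lambda>n. \<integral>x. x ^ k \<partial>\<mu> n)"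
    and f: "continuous_on UNIV f"
  shows "convergent (\<lambda>n. \<integral>x. f x \<partial>\<mu> n)"
proof (rule convergent_of_uniform_approx)
  fix \<epsilon> :: real assume "\<epsilon> > 0"
  have cf: "continuous_on {-C..C} f"
    using f by (rule continuous_on_subset) simp
  obtain g where g: "real_polynomial_function g" "\<And>x. x \<in> {-C..C} \<Longrightarrow> \<bar>f x - g x\<bar> < \<epsilon>"
    using Stone_Weierstrass_real_polynomial_function[OF compact_Icc cf \<open>\<epsilon> > 0\<close>] by blast
  obtain a N where gs: "g = (\<lambda>x. \<Sum>i\<le>N. a i * x ^ i)"
    using real_polynomial_function_imp_sum[OF g(1)] by blast
  have int_pow: "integrable (\<mu> n) (\<lambda>x. x ^ k)" for n k
    by (rule real_distribution.integrable_continuous_of_bounded_support[OF \<mu> supp])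
       (intro continuous_intros)
  have int_f: "integrable (\<mu> n) f" for n
    by (rule real_distribution.integrable_continuous_of_bounded_support[OF \<mu> supp f])
  have int_g: "integrable (\<mu> n) g" for n
    unfolding gs by (intro Bochner_Integration.integrable_sum integrable_mult_right int_pow)
  have "(\<integral>x. g x \<partial>\<mu> n) = (\<Sum>i\<le>N. a i * (\<integral>x. x ^ i \<partial>\<mu> n))" for n
    unfolding gs by (subst Bochner_Integration.integral_sum) (auto intro: int_pow)
  moreover have "convergent (\<lambda>n. \<Sum>i\<le>N. a i * (\<integral>x. x ^ i \<partial>\<mu> n))"
    by (intro convergent_sum convergent_mult convergent_const mom)
  ultimately have "convergent (\<lambda>n. \<integral>x. g x \<partial>\<mu> n)"
    by simp
  moreover have "\<bar>(\<integral>x. f x \<partial>\<mu> n) - (\<integral>x. g x \<partial>\<mu> n)\<bar> \<le> \<epsilon>" for n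
  proof -
    interpret real_distribution "\<mu> n" by (rule \<mu>)
    have "\<bar>(\<integral>x. f x \<partial>\<mu> n) - (\<integral>x. g x \<partial>\<mu> n)\<bar> = \<bar>\<integral>x. f x - g x \<partial>\<mu> n\<bar>"
      by (simp add: int_f int_g)
    also have "\<dots> \<le> (\<integral>x. \<bar>f x - g x\<bar> \<partial>\<mu> n)"
      by (rule integral_abs_bound)
    also have "\<dots> \<le> (\<integral>x. \<epsilon> \<partial>\<mu> n)"
    proof (rule integral_mono_AE)
      show "AE x in \<mu> n. \<bar>f x - g x\<bar> \<le> \<epsilon>"
        using supp[of n] by eventually_elim (rule less_imp_le[OF g(2)], auto)
    qed (auto intro!: int_f int_g integrable_abs Bochner_Integration.integrable_diff)
    also have "\<dots> = \<epsilon>"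
      using prob_space by simp
    finally show ?thesis .
  qed
  ultimately show "\<exists>y. convergent y \<and> (\<forall>n. \<bar>(\<integral>x. f x \<partial>\<mu> n) - y n\<bar> \<le> \<epsilon>)"
    by blast
qed

text \<open>Tightness yields one weakly convergent subsequence with limit \<nu>. Integrals of
  bounded continuous functions converge along the whole sequence, and the subsequence identifies
  their limits.\<close>

lemma weak_conv_of_moments:
  fixes \<mu> :: "nat \<Rightarrow> real measure"
  assumes \<mu>: "\<And>n. real_distribution (\<mu> n)"
    and supp: "\<And>n. AE x in \<mu> n. \<bar>x\<bar> \<le> C"
    and mom: "\<And>k. convergent (\<lambda>n. \<integral>x. x ^ k \<partial>\<mu> n)"
  shows "\<exists>\<nu>. real_distribution \<nu> \<and> weak_conv_m \<mu> \<nu>"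
proof -
  have "tight \<mu>"
    unfolding tight_def
  proof (intro conjI allI impI \<mu>)
    fix \<epsilon> :: real assume "\<epsilon> > 0"
    \<comment> \<open>The widening by 1 covers the excluded left endpoint and ensures
      \<open>a < b\<close>; the absolute value avoids a sign condition on \<open>C\<close>.\<close>
    have "measure (\<mu> n) {- (\<bar>C\<bar> + 1)<..\<bar>C\<bar> + 1} = 1" for n
    proof -
      interpret real_distribution "\<mu> n" by (rule \<mu>)
      have "AE x in \<mu> n. x \<in> {- (\<bar>C\<bar> + 1)<..\<bar>C\<bar> + 1}"
        using supp[of n] by eventually_elim auto
      then show ?thesis
        by (subst prob_eq_1) auto
    qed
    with \<open>\<epsilon> > 0\<close> show "\<exists>a b. a < b \<and> (\<forall>n. 1 - \<epsilon> < measure (\<mu> n) {a<..b})"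
      by (intro exI[of _ "- (\<bar>C\<bar> + 1)"] exI[of _ "\<bar>C\<bar> + 1"]) auto
  qed
  then obtain r \<nu> where r: "strict_mono (r :: nat \<Rightarrow> nat)" and \<nu>: "real_distribution \<nu>"
    and weak: "weak_conv_m (\<mu> \<circ> id \<circ> r) \<nu>"
    using tight_imp_convergent_subsubsequence[of \<mu> id] by (auto simp: strict_mono_def)
  have "weak_conv_m \<mu> \<nu>"
  proof (rule integral_bdd_continuous_conv_imp_weak_conv[OF \<mu> \<nu>])
    fix f :: "real \<Rightarrow> real" assume f: "\<And>x. isCont f x" "\<And>x. \<bar>f x\<bar> \<le> 1"
    have "continuous_on UNIV f"
      using f(1) by (simp add: continuous_at_imp_continuous_on)
    then obtain L where L: "(\<lambda>n. \<integral>x. f x \<partial>\<mu> n) \<longlonglongrightarrow> L"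
      using convergent_integral_of_moments[OF \<mu> supp mom] by (auto simp: convergent_def)
    have "(\<lambda>n. \<integral>x. f x \<partial>(\<mu> \<circ> id \<circ> r) n) \<longlonglongrightarrow> (\<integral>x. f x \<partial>\<nu>)"
      by (rule weak_conv_imp_integral_bdd_continuous_conv[OF _ \<nu> weak f(1), of 1])
         (use \<mu> f(2) in auto)
    moreover have "(\<lambda>n. \<integral>x. f x \<partial>(\<mu> \<circ> id \<circ> r) n) \<longlonglongrightarrow> L"
      using LIMSEQ_subseq_LIMSEQ[OF L r] by (simp add: comp_def)
    ultimately have "L = (\<integral>x. f x \<partial>\<nu>)"
      by (rule LIMSEQ_unique[symmetric])
    with L show "(\<lambda>n. \<integral>x. f x \<partial>\<mu> n) \<longlonglongrightarrow> (\<integral>x. f x \<partial>\<nu>)"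
      by simp
  qed
  with \<nu> show ?thesis by blast
qed

section \<open>Quantile functions and polygons\<close>

text \<open>The function F^* of the statement, the integrand of \<open>polygon\<close>.\<close>

definition quantile :: "real measure \<Rightarrow> real \<Rightarrow> real" where
  "quantile M s = Sup {x. measure M {x<..} > s}"

lemma (in real_distribution) measure_greaterThan_eq_cdf: "measure M {x<..} = 1 - cdf M x"
proof -
  have "{x<..} = space M - {..x}" by auto
  then show ?thesis
    using prob_compl[of "{..x}"] by (simp add: cdf_def)
qed

text \<open>A Galois connection between quantile and tail. As the tail is 1 minus the distribution
  function, the set under the supremum is the open half-line below the pseudo-inverse
  \<open>I\<close> at \<open>1 - s\<close>.\<close>

lemma quantile_iff:
  assumes "real_distribution M" "0 < s" "s < 1"
  shows "x < quantile M s \<longleftrightarrow> s < measure M {x<..}"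
proof -
  interpret cdf_distribution M
    using assms(1) by (simp add: cdf_distribution_def)
  have "s < measure M {x<..} \<longleftrightarrow> x < I (1 - s)" for x
    using pseudoinverse[of "1 - s" x] assms(2,3) by (auto simp: measure_greaterThan_eq_cdf)
  then have "{x. measure M {x<..} > s} = {..<I (1 - s)}"
    by auto
  with \<open>\<And>x. s < measure M {x<..} \<longleftrightarrow> x < I (1 - s)\<close> show ?thesis
    by (simp add: quantile_def)
qed

lemma quantile_antimono:
  assumes "real_distribution M" "0 < s" "s \<le> t" "t < 1"
  shows "quantile M t \<le> quantile M s"
proof (rule dense_le)
  fix x assume "x < quantile M t"
  then have "t < measure M {x<..}"
    using quantile_iff[of M t x] assms by simp
  then have "x < quantile M s"
    using quantile_iff[of M s x] assms by simp
  then show "x \<le> quantile M s" by simp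
qed

lemma quantile_bounded:
  assumes "real_distribution M" "AE x in M. \<bar>x\<bar> \<le> C" "0 < s" "s < 1"
  shows "\<bar>quantile M s\<bar> \<le> C"
proof -
  interpret real_distribution M by fact
  have "prob {C<..} = 0"
    using assms(2) by (subst prob_eq_0) (auto elim: eventually_mono)
  then have "\<not> C < quantile M s"
    using quantile_iff[OF assms(1,3,4), of C] assms(3) by simp
  moreover have "x < quantile M s" if "x < -C" for x
  proof -
    have "prob {x<..} = 1"
      using assms(2) that by (subst prob_eq_1) (auto elim!: eventually_mono)
    then show ?thesis
      using quantile_iff[OF assms(1,3,4), of x] assms(4) by simp
  qed
  then have "-C \<le> quantile M s"
    using dense_le[of "- C" "quantile M s"] less_imp_le by blast
  ultimately show ?thesis by simp
qed

text \<open>Quantiles are compared through points \<open>y\<close> that are not atoms of \<nu>,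
  where the tails converge; such points are dense because atoms are countable.\<close>

lemma quantile_tendsto:
  assumes \<mu>: "\<And>n. real_distribution (\<mu> n)" and \<nu>: "real_distribution \<nu>"
    and weak: "weak_conv_m \<mu> \<nu>" and s: "0 < s" "s < 1"
    and cont: "isCont (quantile \<nu>) s"
  shows "(\<lambda>n. quantile (\<mu> n) s) \<longlonglongrightarrow> quantile \<nu> s"
proof -
  interpret \<nu>: real_distribution \<nu> by fact
  note F = real_distribution.measure_greaterThan_eq_cdf
  have conv: "(\<lambda>n. measure (\<mu> n) {x<..}) \<longlonglongrightarrow> measure \<nu> {x<..}" if "measure \<nu> {x} = 0" for x
  proof -
    have "(\<lambda>n. cdf (\<mu> n) x) \<longlonglongrightarrow> cdf \<nu> x"
      using weak \<nu>.isCont_cdf that by (auto simp: weak_conv_m_def weak_conv_def)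
    then show ?thesis
      unfolding F[OF \<mu>] F[OF \<nu>] by (intro tendsto_intros)
  qed
  have dense: "\<exists>y. a < y \<and> y < b \<and> measure \<nu> {y} = 0" if "a < b" for a b
    using open_minus_countable[OF \<nu>.countable_support, of "{a<..<b}"] that by auto
  show ?thesis
  proof (rule order_tendstoI)
    fix x assume "x < quantile \<nu> s"
    then obtain y where y: "x < y" "y < quantile \<nu> s" "measure \<nu> {y} = 0"
      using dense by blast
    then have "s < measure \<nu> {y<..}"
      using quantile_iff[OF \<nu> s] by simp
    then have "\<forall>\<^sub>F n in sequentially. s < measure (\<mu> n) {y<..}"
      using conv[OF y(3)] by (intro order_tendstoD)
    then show "\<forall>\<^sub>F n in sequentially. x < quantile (\<mu> n) s"
      by eventually_elim (use y(1) quantile_iff[OF \<mu> s, of y] in force)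
  next
    fix x assume x: "quantile \<nu> s < x"
    \<comment> \<open>At \<open>s\<close> itself only a non-strict bound on the tail is available.
      Continuity gives \<open>t < s\<close> with \<open>quantile \<nu> t < x\<close>, so that the
      tail at \<open>y\<close> is at most \<open>t\<close>, strictly below \<open>s\<close>, and
      this persists for large \<open>n\<close>.\<close>
    have "(quantile \<nu> \<longlongrightarrow> quantile \<nu> s) (at_left s)"
      using cont by (simp add: isCont_def filterlim_at_split)
    then have "\<forall>\<^sub>F t in at_left s. quantile \<nu> t < x"
      using x by (rule order_tendstoD)
    moreover have "\<forall>\<^sub>F t in at_left s. 0 < t \<and> t < s"
      using eventually_at_left_real[OF s(1)] by eventually_elim auto
    ultimately have "\<forall>\<^sub>F t in at_left s. quantile \<nu> t < x \<and> 0 < t \<and> t < s"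
      by eventually_elim simp
    then obtain t where t: "quantile \<nu> t < x" "0 < t" "t < s"
      using eventually_happens'[OF trivial_limit_at_left_real] by blast
    then obtain y where y: "quantile \<nu> t < y" "y < x" "measure \<nu> {y} = 0"
      using dense by blast
    then have "measure \<nu> {y<..} < s"
      using quantile_iff[OF \<nu> t(2), of y] t(3) s by linarith
    then have "\<forall>\<^sub>F n in sequentially. measure (\<mu> n) {y<..} < s"
      using conv[OF y(3)] by (intro order_tendstoD)
    then show "\<forall>\<^sub>F n in sequentially. quantile (\<mu> n) s < x"
    proof eventually_elim
      case (elim n)
      then show ?case
        using y(2) quantile_iff[OF \<mu> s, of y n] by linarith
    qed
  qed
qed

section \<open>Polygons as integrals of quantile functions\<close>

text \<open>Outside the open unit interval the supremum may run over the empty set or the whole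
  line, so the value is set to 0 there.\<close>

definition quantile01 :: "real measure \<Rightarrow> real \<Rightarrow> real" where
  "quantile01 M s = indicator {0<..<1} s * quantile M s"

text \<open>The sign makes the function nondecreasing, so that measurability and countability of
  discontinuities follow from monotonicity.\<close>

lemma mono_on_neg_quantile:
  "real_distribution M \<Longrightarrow> mono_on {0<..<1} (\<lambda>s. - quantile M s)"
  by (auto simp: mono_on_def intro: quantile_antimono)

lemma measurable_quantile01:
  assumes "real_distribution M"
  shows "quantile01 M \<in> borel_measurable borel"
proof -
  have "(\<lambda>s. - quantile M s) \<in> borel_measurable (restrict_space borel {0<..<1})"
    by (intro borel_measurable_mono_on_fnc mono_on_neg_quantile assms)
  then have "(\<lambda>s. indicator {0<..<1} s *\<^sub>R (- quantile M s)) \<in> borel_measurable borel"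
    by (subst (asm) borel_measurable_restrict_space_iff) auto
  then have "(\<lambda>s. - (indicator {0<..<1} s *\<^sub>R (- quantile M s))) \<in> borel_measurable borel"
    by (rule borel_measurable_uminus)
  then show ?thesis
    by (simp add: quantile01_def[abs_def])
qed

lemma polygon_eq:
  assumes "t \<in> {0..1}"
  shows "polygon M t = (\<integral>s. indicator {0<..<t} s * quantile01 M s \<partial>lborel)"
proof -
  have "polygon M t = (\<integral>s. indicator {0<..<t} s * quantile M s \<partial>lborel)"
    using assms unfolding polygon_def quantile_def[symmetric]
    by (simp add: interval_lebesgue_integral_def set_lebesgue_integral_def einterval_eq zero_ereal_def)
  also have "\<dots> = (\<integral>s. indicator {0<..<t} s * quantile01 M s \<partial>lborel)"
    using assms by (intro Bochner_Integration.integral_cong) (auto simp: quantile01_def indicator_def)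
  finally show ?thesis .
qed

text \<open>Convergence can fail only at discontinuities of a monotone function, a countable and
  hence null set.\<close>

lemma AE_quantile01_tendsto:
  assumes \<mu>: "\<And>n. real_distribution (\<mu> n)" and \<nu>: "real_distribution \<nu>"
    and weak: "weak_conv_m \<mu> \<nu>"
  shows "AE s in lborel. (\<lambda>n. quantile01 (\<mu> n) s) \<longlonglongrightarrow> quantile01 \<nu> s"
proof -
  let ?D = "{s\<in>{0<..<1}. \<not> isCont (\<lambda>s. - quantile \<nu> s) s}"
  have "countable ?D"
    using mono_on_ctble_discont[OF mono_on_neg_quantile[OF \<nu>]]
    by (simp add: at_within_open[of _ "{0 <..< 1}"] cong: conj_cong)
  then have "AE s in lborel. s \<notin> ?D"
    by (intro AE_not_in countable_imp_null_set_lborel)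
  then show ?thesis
  proof eventually_elim
    case (elim s)
    show ?case
    proof (cases "s \<in> {0<..<1}")
      case True
      with elim have "isCont (\<lambda>s. - quantile \<nu> s) s"
        by blast
      then have "isCont (quantile \<nu>) s"
        using continuous_minus[of "at s" "\<lambda>s. - quantile \<nu> s"] by simp
      with True show ?thesis
        using quantile_tendsto[OF \<mu> \<nu> weak, of s] by (simp add: quantile01_def)
    qed (simp add: quantile01_def)
  qed
qed

lemma integrable_indicator_01: "integrable lborel (\<lambda>s::real. C * indicator {0<..<1} s :: real)"
  by (intro integrable_mult_right) simp

text \<open>Dominated convergence gives L1 convergence of the quantile functions, and the L1
  distance bounds the difference of the polygons at every \<open>t\<close> simultaneously.\<close>

lemma polygon_uniform_limit:
  assumes \<mu>: "\<And>n. real_distribution (\<mu> n)" and \<nu>: "real_distribution \<nu>"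
    and weak: "weak_conv_m \<mu> \<nu>"
    and supp: "\<And>n. AE x in \<mu> n. \<bar>x\<bar> \<le> C"
  shows "integrable lborel (quantile01 \<nu>)"
    and "uniform_limit {0..1} (\<lambda>n. polygon (\<mu> n)) (polygon \<nu>) sequentially"
proof -
  note [measurable] = measurable_quantile01[OF \<mu>] measurable_quantile01[OF \<nu>]
  have bnd: "norm (quantile01 (\<mu> n) s) \<le> C * indicator {0<..<1} s" for n s
    using quantile_bounded[OF \<mu> supp, of s n] by (auto simp: quantile01_def indicator_def)
  have AE: "AE s in lborel. (\<lambda>n. quantile01 (\<mu> n) s) \<longlonglongrightarrow> quantile01 \<nu> s"
    by (rule AE_quantile01_tendsto[OF \<mu> \<nu> weak])
  \<comment> \<open>The bound on the approximants passes to the limit, so no support bound for \<nu>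
    has to be established.\<close>
  show int\<nu>: "integrable lborel (quantile01 \<nu>)"
    by (rule integrable_dominated_convergence[OF _ _ integrable_indicator_01 AE AE_I2[OF bnd]])
       measurable
  have int\<mu>: "integrable lborel (quantile01 (\<mu> n))" for n
    by (rule integrable_dominated_convergence2[OF _ _ integrable_indicator_01 AE AE_I2[OF bnd]])
       measurable
  define \<Delta> where "\<Delta> n = (\<integral>s. \<bar>quantile01 (\<mu> n) s - quantile01 \<nu> s\<bar> \<partial>lborel)" for n
  have "\<Delta> \<longlonglongrightarrow> (\<integral>s. 0 \<partial>(lborel :: real measure))"
    unfolding \<Delta>_def
  proof (rule integral_dominated_convergence)
    show "AE s in lborel. (\<lambda>n. \<bar>quantile01 (\<mu> n) s - quantile01 \<nu> s\<bar>) \<longlonglongrightarrow> 0"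
      using AE by eventually_elim (rule tendsto_rabs_zero, rule LIM_zero)
    show "integrable lborel (\<lambda>s. C * indicator {0<..<1} s + \<bar>quantile01 \<nu> s\<bar>)"
      by (intro Bochner_Integration.integrable_add integrable_indicator_01 integrable_abs int\<nu>)
    show "AE s in lborel. norm \<bar>quantile01 (\<mu> n) s - quantile01 \<nu> s\<bar>
        \<le> C * indicator {0<..<1} s + \<bar>quantile01 \<nu> s\<bar>" for n
    proof (rule AE_I2)
      fix s
      show "norm \<bar>quantile01 (\<mu> n) s - quantile01 \<nu> s\<bar> \<le> C * indicator {0<..<1} s + \<bar>quantile01 \<nu> s\<bar>"
        using bnd[of n s] unfolding real_norm_def by linarith
    qed
  qed measurable
  then have \<Delta>: "\<Delta> \<longlonglongrightarrow> 0" by simp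
  have le: "\<bar>polygon (\<mu> n) t - polygon \<nu> t\<bar> \<le> \<Delta> n" if "t \<in> {0..1}" for n t
  proof -
    have i: "integrable lborel (\<lambda>s. indicator {0<..<t} s * quantile01 (\<mu> n) s)"
      "integrable lborel (\<lambda>s. indicator {0<..<t} s * quantile01 \<nu> s)"
      using integrable_mult_indicator[OF _ int\<mu>, of "{0<..<t}"]
        integrable_mult_indicator[OF _ int\<nu>, of "{0<..<t}"] by simp_all
    have "\<bar>polygon (\<mu> n) t - polygon \<nu> t\<bar>
      = \<bar>\<integral>s. indicator {0<..<t} s * quantile01 (\<mu> n) s - indicator {0<..<t} s * quantile01 \<nu> s \<partial>lborel\<bar>"
      unfolding polygon_eq[OF that] using i by simp
    also have "\<dots> \<le> (\<integral>s. \<bar>indicator {0<..<t} s * quantile01 (\<mu> n) s - indicator {0<..<t} s * quantile01 \<nu> s\<bar> \<partial>lborel)"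
      by (rule integral_abs_bound)
    also have "\<dots> \<le> \<Delta> n"
      unfolding \<Delta>_def
    proof (rule integral_mono)
      fix s
      show "\<bar>indicator {0<..<t} s * quantile01 (\<mu> n) s - indicator {0<..<t} s * quantile01 \<nu> s\<bar>
        \<le> \<bar>quantile01 (\<mu> n) s - quantile01 \<nu> s\<bar>"
        by (auto simp: indicator_def)
    qed (auto intro!: i int\<mu> int\<nu>)
    finally show ?thesis .
  qed
  show "uniform_limit {0..1} (\<lambda>n. polygon (\<mu> n)) (polygon \<nu>) sequentially"
  proof (rule uniform_limitI)
    fix \<epsilon> :: real assume "\<epsilon> > 0"
    with \<Delta> have "\<forall>\<^sub>F n in sequentially. \<Delta> n < \<epsilon>"
      by (rule order_tendstoD)
    then show "\<forall>\<^sub>F n in sequentially. \<forall>t\<in>{0..1}. dist (polygon (\<mu> n) t) (polygon \<nu> t) < \<epsilon>"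
      by eventually_elim (auto simp: dist_real_def intro: le_less_trans[OF le])
  qed
qed

text \<open>The quantile is nonincreasing, so its value at \<open>z\<close> lies between the mean
  slope of the polygon on \<open>[x, z]\<close> from above and that on \<open>[z, y]\<close> from
  below.\<close>

lemma concave_polygon:
  assumes M: "real_distribution M" and int: "integrable lborel (quantile01 M)"
  shows "concave_on {0..1} (polygon M)"
proof (rule concave_on_linorderI)
  fix u x y :: real
  assume u: "0 < u" "u < 1" and xy: "x \<in> {0..1}" "y \<in> {0..1}" "x < y"
  define z where "z = (1 - u) * x + u * y"
  have zx: "z - x = u * (y - x)" and yz: "y - z = (1 - u) * (y - x)"
    by (simp_all add: z_def algebra_simps)
  then have z: "x < z" "z < y"
    using u xy by (metis diff_gt_0_iff_gt mult_pos_pos, metis diff_gt_0_iff_gt mult_pos_pos)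
  have iM: "integrable lborel (\<lambda>s. indicator A s * quantile01 M s)" if "A \<in> sets borel" for A :: "real set"
    using integrable_mult_indicator[OF _ int, of A] that by simp
  have diff: "polygon M b - polygon M a = (\<integral>s. indicator {a..<b} s * quantile01 M s \<partial>lborel)"
    if "0 \<le> a" "a \<le> b" "b \<le> 1" for a b
  proof -
    have "polygon M b - polygon M a
      = (\<integral>s. indicator {0<..<b} s * quantile01 M s - indicator {0<..<a} s * quantile01 M s \<partial>lborel)"
      using that by (simp add: polygon_eq iM)
    also have "\<dots> = (\<integral>s. indicator {a..<b} s * quantile01 M s \<partial>lborel)"
      using that by (intro Bochner_Integration.integral_cong) (auto simp: indicator_def quantile01_def)
    finally show ?thesis .
  qed
  have const: "(\<integral>s. indicator {a..<b} s * c \<partial>lborel) = (b - a) * c" if "a \<le> b" for a b c :: real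
    using that by simp
  have int_const: "integrable lborel (\<lambda>s. indicator {a..<b} s * c)" if "a \<le> b" for a b c :: real
    using that by (intro integrable_mult_left integrable_real_indicator) auto
  let ?q = "quantile M z"
  have lower: "u * (y - x) * ?q \<le> polygon M z - polygon M x"
  proof -
    have "(\<integral>s. indicator {x..<z} s * ?q \<partial>lborel) \<le> (\<integral>s. indicator {x..<z} s * quantile01 M s \<partial>lborel)"
    proof (rule integral_mono_AE)
      \<comment> \<open>For \<open>x = 0\<close> the interval contains 0, where
        \<open>quantile01\<close> is 0 and the inequality may fail; this null point is
        removed.\<close>
      show "AE s in lborel. indicator {x..<z} s * ?q \<le> indicator {x..<z} s * quantile01 M s"
        using AE_lborel_singleton[of 0]
        by eventually_elim
           (use xy z in \<open>auto simp: indicator_def quantile01_def intro!: quantile_antimono[OF M]\<close>)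
    qed (use z in \<open>auto intro!: iM int_const\<close>)
    then show ?thesis
      using diff[of x z] const[of x z ?q] xy z zx by simp
  qed
  have upper: "polygon M y - polygon M z \<le> (1 - u) * (y - x) * ?q"
  proof -
    have "(\<integral>s. indicator {z..<y} s * quantile01 M s \<partial>lborel) \<le> (\<integral>s. indicator {z..<y} s * ?q \<partial>lborel)"
    proof (rule integral_mono)
      show "indicator {z..<y} s * quantile01 M s \<le> indicator {z..<y} s * ?q" for s
        using xy z by (auto simp: indicator_def quantile01_def intro!: quantile_antimono[OF M])
    qed (use z in \<open>auto intro!: iM int_const\<close>)
    then show ?thesis
      using diff[of z y] const[of z y ?q] xy z yz by simp
  qed
  \<comment> \<open>With the weights \<open>u\<close> and \<open>1 - u\<close> both slope bounds
    become the same number, which links the two increments.\<close>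
  have "u * (polygon M y - polygon M z) \<le> u * ((1 - u) * (y - x) * ?q)"
    using upper u by (intro mult_left_mono) auto
  also have "\<dots> = (1 - u) * (u * (y - x) * ?q)"
    by simp
  also have "\<dots> \<le> (1 - u) * (polygon M z - polygon M x)"
    using lower u by (intro mult_left_mono) auto
  finally have "(1 - u) * polygon M x + u * polygon M y \<le> polygon M z"
    by (simp add: algebra_simps)
  then show "(1 - u) * polygon M x + u * polygon M y \<le> polygon M ((1 - u) *\<^sub>R x + u *\<^sub>R y)"
    by (simp add: z_def)
qed simp

section \<open>The measures attached to the rows\<close>

text \<open>Complements give the open lower half-lines, an intersection-stable generator. This
  uniqueness makes the description in \<open>filt_measure\<close> definite.\<close>

lemma prob_measure_eqI_atLeast:
  fixes \<mu> \<nu> :: "real measure"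
  assumes "sets \<mu> = sets borel" "sets \<nu> = sets borel" "prob_space \<mu>" "prob_space \<nu>"
    and eq: "\<And>r. measure \<mu> {r..} = measure \<nu> {r..}"
  shows "\<mu> = \<nu>"
proof -
  interpret \<mu>: prob_space \<mu> by fact
  interpret \<nu>: prob_space \<nu> by fact
  have sp: "space \<mu> = UNIV" "space \<nu> = UNIV"
    using assms(1,2)[THEN sets_eq_imp_space_eq] by simp_all
  have less: "emeasure \<mu> {..<r} = emeasure \<nu> {..<r}" for r
  proof -
    have "{..<r} = UNIV - {r..}" by auto
    then have "measure \<mu> {..<r} = measure \<nu> {..<r}"
      using \<mu>.prob_compl[of "{r..}"] \<nu>.prob_compl[of "{r..}"] eq[of r] sp assms(1,2) by simp
    then show ?thesis
      by (simp add: \<mu>.emeasure_eq_measure \<nu>.emeasure_eq_measure)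
  qed
  show ?thesis
  proof (rule measure_eqI_generator_eq[where \<Omega> = UNIV and E = "range lessThan" and A = "\<lambda>n. {..<real n}"])
    show "Int_stable (range (lessThan :: real \<Rightarrow> real set))"
    proof (rule Int_stableI, clarsimp)
      fix a b :: real
      have "{..<a} \<inter> {..<b} = {..<min a b}" by auto
      then show "{..<a} \<inter> {..<b} \<in> range lessThan" by blast
    qed
    show "sets \<mu> = sigma_sets UNIV (range lessThan)" "sets \<nu> = sigma_sets UNIV (range lessThan)"
      using assms(1,2) by (simp_all add: borel_eq_lessThan eucl_less_def lessThan_def)
    show "(\<Union>n. {..<real n}) = UNIV"
      using reals_Archimedean2 by auto
  qed (auto simp: less)
qed

lemma measure_distr_pmf_of_set:
  assumes "finite B" "B \<noteq> {}" "A \<in> sets borel"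
  shows "measure (distr (measure_pmf (pmf_of_set B)) borel X) A = card {p\<in>B. X p \<in> A} / card B"
  using assms by (simp add: measure_distr measure_pmf_of_set Int_def vimage_def)

lemma real_distribution_distr_pmf:
  fixes X :: "'a \<Rightarrow> real"
  shows "real_distribution (distr (measure_pmf p) borel X)"
  by (intro prob_space.real_distribution_distr measure_pmf.prob_space_axioms) simp

lemma AE_distr_pmf_of_set:
  fixes X :: "'a \<Rightarrow> real"
  assumes "finite B" "B \<noteq> {}" "\<And>p. p \<in> B \<Longrightarrow> \<bar>X p\<bar> \<le> C"
  shows "AE x in distr (measure_pmf (pmf_of_set B)) borel X. \<bar>x\<bar> \<le> C"
  using assms by (subst AE_distr_iff) (auto simp: AE_measure_pmf_iff)

lemma integral_distr_pmf_of_set: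
  fixes X :: "'a \<Rightarrow> real" and g :: "real \<Rightarrow> real"
  assumes "finite B" "B \<noteq> {}" "g \<in> borel_measurable borel"
  shows "(\<integral>x. g x \<partial>distr (measure_pmf (pmf_of_set B)) borel X) = (\<Sum>p\<in>B. g (X p)) / card B"
  using assms by (subst integral_distr) (auto simp: integral_pmf_of_set)

lemma scale_measure_by_distr_pmf:
  "scale_measure_by c (distr (measure_pmf p) borel X) = distr (measure_pmf p) borel (\<lambda>i. c * X i)"
  unfolding scale_measure_by_def by (subst distr_distr) (auto simp: comp_def)

lemma integral_null_measure_borel: "(\<integral>x. g x \<partial>null_measure (borel :: real measure)) = (0 :: real)"
  by (rule integral_eq_zero_AE, rule AE_I[where N = UNIV]) auto

section \<open>Empirical measures of the rows and their moments\<close>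

context bigraded_gens
begin

text \<open>By the dimension formulas the required tails are proportions of standard monomials,
  which the empirical measure of their second degrees realises; uniqueness does the rest.\<close>

lemma filt_measure_row:
  assumes "std_row n \<noteq> {}"
  shows "filt_measure sc (row_space sc Mg n) (row_filt sc Mg n)
    = distr (measure_pmf (pmf_of_set (std_row n))) borel (\<lambda>p. real_of_int (cdeg p))"
    (is "_ = ?\<mu>")
proof -
  have card: "card (std_row n) \<noteq> 0"
    using assms finite_std_row by simp
  interpret \<mu>: real_distribution ?\<mu>
    by (rule real_distribution_distr_pmf)
  have \<mu>: "measure ?\<mu> {r..} = real (dim (row_filt sc Mg n r)) / real (dim (row_space sc Mg n))" for r
    using measure_distr_pmf_of_set[OF finite_std_row assms, of "{r..}"]
    by (simp add: dim_row_filt dim_row_space)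
  have "(THE \<mu>. sets \<mu> = sets borel \<and> prob_space \<mu> \<and>
      (\<forall>r. measure \<mu> {r..} = real (dim (row_filt sc Mg n r)) / real (dim (row_space sc Mg n)))) = ?\<mu>"
  proof (rule the_equality)
    show "sets ?\<mu> = sets borel \<and> prob_space ?\<mu> \<and>
      (\<forall>r. measure ?\<mu> {r..} = real (dim (row_filt sc Mg n r)) / real (dim (row_space sc Mg n)))"
      using \<mu> \<mu>.prob_space_axioms by simp
    show "\<mu>' = ?\<mu>" if "sets \<mu>' = sets borel \<and> prob_space \<mu>' \<and>
      (\<forall>r. measure \<mu>' {r..} = real (dim (row_filt sc Mg n r)) / real (dim (row_space sc Mg n)))" for \<mu>'
      using that \<mu> \<mu>.prob_space_axioms by (intro prob_measure_eqI_atLeast) auto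
  qed
  then show ?thesis
    unfolding filt_measure_def using card by (simp add: dim_row_space)
qed

lemma filt_measure_row_empty:
  "std_row n = {} \<Longrightarrow> filt_measure sc (row_space sc Mg n) (row_filt sc Mg n) = null_measure borel"
  by (simp add: filt_measure_def dim_row_space)

text \<open>The cardinality is the power sum of order 0, hence eventually a polynomial: either zero
  or nonvanishing for large \<open>n\<close>.\<close>

lemma std_row_eventually_empty_or_nonempty:
  "(\<forall>\<^sub>F n in sequentially. std_row (int n) = {}) \<or> (\<forall>\<^sub>F n in sequentially. std_row (int n) \<noteq> {})"
proof -
  have "eventually_poly (\<lambda>n. real (card (std_row (int n))))"
    using eventually_poly_std_row[of 0] by simp
  then obtain q where q: "\<forall>\<^sub>F n in sequentially. real (card (std_row (int n))) = poly q (real n)"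
    by (auto simp: eventually_poly_def)
  show ?thesis
  proof (cases "q = 0")
    case True
    have "\<forall>\<^sub>F n in sequentially. std_row (int n) = {}"
      using q by eventually_elim (simp add: True finite_std_row)
    then show ?thesis ..
  next
    case False
    have "\<forall>\<^sub>F n in sequentially. std_row (int n) \<noteq> {}"
      using q poly_eventually_nonzero[OF False] by eventually_elim auto
    then show ?thesis ..
  qed
qed

lemma moments_convergent:
  assumes ne: "\<forall>\<^sub>F n in sequentially. std_row (int n) \<noteq> {}"
  shows "convergent (\<lambda>n. (\<Sum>p\<in>std_row (int n). (1 / real n * real_of_int (cdeg p)) ^ k)
    / card (std_row (int n)))"
proof -
  let ?a = "\<lambda>n. \<Sum>p\<in>std_row (int n). real_of_int (cdeg p) ^ k"
  let ?b = "\<lambda>n. real n ^ k * real (card (std_row (int n)))"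
  obtain C where C: "C > 0"
    "\<And>n p. n \<ge> 1 \<Longrightarrow> p \<in> std_row (int n) \<Longrightarrow> \<bar>real_of_int (cdeg p)\<bar> \<le> C * real n"
    using cdeg_linear_bound by blast
  have "convergent (\<lambda>n. ?a n / ?b n)"
  proof (rule eventually_poly_quotient_convergent)
    show "eventually_poly ?a"
      by (rule eventually_poly_std_row)
    show "eventually_poly ?b"
      using eventually_poly_std_row[of 0] by (intro eventually_poly_power_mult) simp
    show "\<forall>\<^sub>F n in sequentially. ?b n \<noteq> 0"
      using ne eventually_gt_at_top[of "0::nat"]
      by eventually_elim (simp add: finite_std_row)
    show "\<forall>\<^sub>F n in sequentially. \<bar>?a n\<bar> \<le> C ^ k * \<bar>?b n\<bar>"
      using eventually_ge_at_top[of "1::nat"]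
    proof eventually_elim
      case (elim n)
      have "\<bar>?a n\<bar> \<le> (\<Sum>p\<in>std_row (int n). \<bar>real_of_int (cdeg p) ^ k\<bar>)"
        by (rule sum_abs)
      also have "\<dots> \<le> (\<Sum>p\<in>std_row (int n). (C * real n) ^ k)"
        using C(2)[OF elim] by (intro sum_mono) (auto simp: power_abs intro: power_mono)
      also have "\<dots> = C ^ k * \<bar>?b n\<bar>"
        by (simp add: power_mult_distrib abs_mult)
      finally show ?case .
    qed
  qed
  \<comment> \<open>This includes \<open>n = 0\<close>: for \<open>k > 0\<close> both sides are 0
    because division by 0 gives 0, and for \<open>k = 0\<close> no scaling occurs.\<close>
  moreover have "(\<Sum>p\<in>std_row (int n). (1 / real n * real_of_int (cdeg p)) ^ k) / card (std_row (int n))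
      = ?a n / ?b n" for n
    by (simp add: power_divide sum_divide_distrib[symmetric])
  ultimately show ?thesis
    by simp
qed

end

lemma bounded_of_compact_support:
  fixes g :: "real \<Rightarrow> real"
  assumes "continuous_on UNIV g" "compact (closure {x. g x \<noteq> 0})"
  obtains B where "\<And>x. norm (g x) \<le> B"
proof -
  have "compact (g ` closure {x. g x \<noteq> 0})"
    using assms by (intro compact_continuous_image) (auto intro: continuous_on_subset)
  then obtain B where B: "B > 0" "\<And>x. x \<in> closure {x. g x \<noteq> 0} \<Longrightarrow> norm (g x) \<le> B"
    using compact_imp_bounded bounded_pos by (metis (no_types, lifting) imageI)
  have "norm (g x) \<le> B" for x
    using B closure_subset[of "{x. g x \<noteq> 0}"] by (cases "g x = 0") auto
  then show thesis by (rule that)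
qed

section \<open>Assembly of the convergence statements\<close>

theorem mainTheorem19:
  fixes sc :: "'k::field \<Rightarrow> 'm::ab_group_add \<Rightarrow> 'm"
    and m :: nat and f :: "nat \<Rightarrow> nat \<times> nat"
    and T :: "nat \<Rightarrow> 'm \<Rightarrow> 'm" and Mg :: "int \<Rightarrow> int \<Rightarrow> 'm set"
  assumes f1: "\<forall>i<m. fst (f i) = 1"
    and bigr: "bigraded_module sc m f T Mg"
    and fg: "finitely_generated_module sc m T"
  defines "\<nu>s \<equiv> (\<lambda>n::nat. filt_measure sc (row_space sc Mg (int n)) (row_filt sc Mg (int n)))"
  shows "\<exists>\<nu>. sets \<nu> = sets borel \<and> (\<forall>C. compact C \<longrightarrow> emeasure \<nu> C < \<infinity>)
           \<and> vague_conv (\<lambda>n. scale_measure_by (1 / real n) (\<nu>s n)) \<nu>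
           \<and> ((\<forall>\<^sub>F n in sequentially. row_space sc Mg (int n) \<noteq> {0}) \<longrightarrow>
                prob_space \<nu> \<and>
                (\<exists>h. concave_on {0..1} h \<and>
                     uniform_limit {0..1} (\<lambda>n. polygon (scale_measure_by (1 / real n) (\<nu>s n))) h sequentially))"
proof -
  obtain r g e \<delta> where "bigraded_gens sc m f T Mg r g e \<delta>"
    using bigraded_gens_exist[OF f1 bigr fg] by blast
  then interpret bigraded_gens sc m f T Mg r g e \<delta> .
  let ?sc = "\<lambda>n. scale_measure_by (1 / real n) (\<nu>s n)"
  consider (empty) "\<forall>\<^sub>F n in sequentially. std_row (int n) = {}"
    | (nonempty) "\<forall>\<^sub>F n in sequentially. std_row (int n) \<noteq> {}"
    using std_row_eventually_empty_or_nonempty by blast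
  then show ?thesis
  proof cases
    case empty
    \<comment> \<open>If almost all rows vanish, almost all measures are null and so is the limit;
      the claim on polygons is then vacuous.\<close>
    have "vague_conv ?sc (null_measure borel)"
      unfolding vague_conv_def
    proof (intro allI impI)
      fix g :: "real \<Rightarrow> real"
      assume "continuous_on UNIV g \<and> compact (closure {x. g x \<noteq> 0})"
      then have g: "g \<in> borel_measurable borel"
        by (intro borel_measurable_continuous_onI) simp
      have "\<forall>\<^sub>F n in sequentially. (\<integral>x. g x \<partial>?sc n) = 0"
        using empty
      proof eventually_elim
        case (elim n)
        then have "\<nu>s n = null_measure borel"
          by (simp add: \<nu>s_def filt_measure_row_empty)
        then show ?case
          using g by (simp add: scale_measure_by_def integral_distr integral_null_measure_borel)
      qed
      then show "(\<lambda>n. \<integral>x. g x \<partial>?sc n) \<longlonglongrightarrow> (\<integral>x. g x \<partial>null_measure borel)"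
        unfolding integral_null_measure_borel by (rule tendsto_eventually)
    qed
    moreover have "\<not> (\<forall>\<^sub>F n in sequentially. row_space sc Mg (int n) \<noteq> {0})"
    proof
      assume "\<forall>\<^sub>F n in sequentially. row_space sc Mg (int n) \<noteq> {0}"
      with empty have "eventually (\<lambda>n. False) sequentially"
        by eventually_elim (simp add: row_space_eq_span_std)
      then show False by simp
    qed
    ultimately show ?thesis
      by (intro exI[of _ "null_measure borel"]) simp
  next
    case nonempty
    then obtain N0 where "\<And>n. n \<ge> N0 \<Longrightarrow> std_row (int n) \<noteq> {}"
      by (auto simp: eventually_sequentially)
    \<comment> \<open>From \<open>N\<close> on every row is nonzero and \<open>1 / real n\<close> is
      a genuine inverse, so each shifted measure is a probability measure; both limits are
      transported back along the shift.\<close>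
    then obtain N where N: "N \<ge> 1" "\<And>n. std_row (int (n + N)) \<noteq> {}"
      by (metis le_add2 max.cobounded1 max.cobounded2 order_trans)
    obtain C where C: "C > 0"
      "\<And>n p. n \<ge> 1 \<Longrightarrow> p \<in> std_row (int n) \<Longrightarrow> \<bar>real_of_int (cdeg p)\<bar> \<le> C * real n"
      using cdeg_linear_bound by blast
    define \<mu> where "\<mu> n = ?sc (n + N)" for n
    have \<mu>_eq: "\<mu> n = distr (measure_pmf (pmf_of_set (std_row (int (n + N))))) borel
        (\<lambda>p. 1 / real (n + N) * real_of_int (cdeg p))" for n
      unfolding \<mu>_def \<nu>s_def filt_measure_row[OF N(2)] scale_measure_by_distr_pmf ..
    have rd: "real_distribution (\<mu> n)" for n
      unfolding \<mu>_eq by (rule real_distribution_distr_pmf)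
    have supp: "AE x in \<mu> n. \<bar>x\<bar> \<le> C" for n
      unfolding \<mu>_eq
    proof (rule AE_distr_pmf_of_set[OF finite_std_row N(2)])
      fix p assume "p \<in> std_row (int (n + N))"
      then have "\<bar>real_of_int (cdeg p)\<bar> \<le> C * real (n + N)"
        using N(1) by (intro C(2)) auto
      moreover have "real (n + N) > 0"
        using N(1) by simp
      ultimately show "\<bar>1 / real (n + N) * real_of_int (cdeg p)\<bar> \<le> C"
        by (simp add: abs_mult divide_le_eq del: of_nat_add)
    qed
    have mom: "convergent (\<lambda>n. \<integral>x. x ^ k \<partial>\<mu> n)" for k
    proof -
      have "(\<integral>x. x ^ k \<partial>\<mu> n) = (\<Sum>p\<in>std_row (int (n + N)). (1 / real (n + N) * real_of_int (cdeg p)) ^ k)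
          / card (std_row (int (n + N)))" for n
        unfolding \<mu>_eq by (rule integral_distr_pmf_of_set[OF finite_std_row N(2)]) simp
      moreover have "convergent (\<lambda>n. (\<Sum>p\<in>std_row (int (n + N)).
          (1 / real (n + N) * real_of_int (cdeg p)) ^ k) / card (std_row (int (n + N))))"
        using convergent_ignore_initial_segment[THEN iffD2, OF moments_convergent[OF nonempty]] .
      ultimately show ?thesis
        by simp
    qed
    obtain \<nu> where \<nu>: "real_distribution \<nu>" and weak: "weak_conv_m \<mu> \<nu>"
      using weak_conv_of_moments[OF rd supp mom] by blast
    interpret \<nu>: real_distribution \<nu> by (rule \<nu>)
    have vague: "vague_conv ?sc \<nu>"
      unfolding vague_conv_def
    proof (intro allI impI)
      fix g :: "real \<Rightarrow> real"
      assume g: "continuous_on UNIV g \<and> compact (closure {x. g x \<noteq> 0})"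
      then obtain B where "\<And>x. norm (g x) \<le> B"
        using bounded_of_compact_support by blast
      moreover have "isCont g x" for x
        using g by (simp add: continuous_on_eq_continuous_at)
      ultimately have "(\<lambda>n. \<integral>x. g x \<partial>\<mu> n) \<longlonglongrightarrow> (\<integral>x. g x \<partial>\<nu>)"
        by (intro weak_conv_imp_integral_bdd_continuous_conv[OF rd \<nu> weak])
      then show "(\<lambda>n. \<integral>x. g x \<partial>?sc n) \<longlonglongrightarrow> (\<integral>x. g x \<partial>\<nu>)"
        unfolding \<mu>_def by (rule LIMSEQ_offset)
    qed
    note lim = polygon_uniform_limit[OF rd \<nu> weak supp]
    have "uniform_limit {0..1} (\<lambda>n. polygon (?sc n)) (polygon \<nu>) sequentially"
      unfolding uniform_limit_iff
    proof (intro allI impI)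
      fix \<epsilon> :: real assume "\<epsilon> > 0"
      then have "\<forall>\<^sub>F n in sequentially. \<forall>t\<in>{0..1}. dist (polygon (?sc (n + N)) t) (polygon \<nu> t) < \<epsilon>"
        using uniform_limitD[OF lim(2)] unfolding \<mu>_def by blast
      then show "\<forall>\<^sub>F n in sequentially. \<forall>t\<in>{0..1}. dist (polygon (?sc n) t) (polygon \<nu> t) < \<epsilon>"
        by (rule eventually_sequentially_seg[THEN iffD1])
    qed
    with vague show ?thesis
      using concave_polygon[OF \<nu> lim(1)] \<nu>.prob_space_axioms
      by (intro exI[of _ \<nu>] conjI) (auto simp: less_top[symmetric])
  qed
qed

end
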